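(* For $m\in\mathbb Z_{>0}$ and $J\subset[1,m-1]$, the assignments $$T_1\mapsto T_{w_\circ^{[1,2m-1]\cup(2m+J)}},\qquad T_2\mapsto T_{w_\circ^{[m+1,3m-1]\cup J}}$$ define a homomorphism of monoids $\mathrm{Br}^+_3\to\mathrm{Br}^+_{3m}$.
   Context: $[a,b]=\{i\in\mathbb Z:a\le i\le b\}$ (empty if $a>b$), and $2m+J=\{2m+j:j\in J\}$. $\mathrm{Br}^+_n$ is the braid monoid on $n$ strands: generators $T_1,\dots,T_{n-1}$, relations $T_iT_j=T_jT_i$ for $|i-j|>1$ and $T_iT_jT_i=T_jT_iT_j$ for $|i-j|=1$. The associated Coxeter group is the symmetric group $S_n$ with simple generators $s_i=(i,i+1)$. For $w\in S_n$, $T_w=T_{i_1}\cdots T_{i_k}$ for any reduced expression $w=s_{i_1}\cdots s_{i_k}$. For $K\subset[1,n-1]$, $w_\circ^K$ is the longest element of the parabolic subgroup $\langle s_k:k\in K\rangle$. *)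

theory Defs
  imports "HOL-Algebra.Sym_Groups"
begin

section \<open>The positive braid monoid on n strands\<close>

text \<open>The congruence on words over the alphabet \<open>{1..<n}\<close> generated by the braid relations;
  the letter \<open>i\<close> stands for the generator \<open>T\<^sub>i\<close>.\<close>

inductive_set braid_cong :: "nat \<Rightarrow> (nat list \<times> nat list) set" for n :: nat where
  comm: "\<lbrakk>i \<in> {1..<n}; j \<in> {1..<n}; \<bar>int i - int j\<bar> > 1\<rbrakk> \<Longrightarrow> ([i, j], [j, i]) \<in> braid_cong n"
| braid: "\<lbrakk>i \<in> {1..<n}; j \<in> {1..<n}; \<bar>int i - int j\<bar> = 1\<rbrakk>
    \<Longrightarrow> ([i, j, i], [j, i, j]) \<in> braid_cong n"
| refl: "u \<in> lists {1..<n} \<Longrightarrow> (u, u) \<in> braid_cong n"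
| sym: "(u, v) \<in> braid_cong n \<Longrightarrow> (v, u) \<in> braid_cong n"
| trans: "\<lbrakk>(u, v) \<in> braid_cong n; (v, w) \<in> braid_cong n\<rbrakk> \<Longrightarrow> (u, w) \<in> braid_cong n"
| mult: "\<lbrakk>(u, u') \<in> braid_cong n; (v, v') \<in> braid_cong n\<rbrakk> \<Longrightarrow> (u @ v, u' @ v') \<in> braid_cong n"

definition braid_class :: "nat \<Rightarrow> nat list \<Rightarrow> nat list set" where
  "braid_class n u = braid_cong n `` {u}"

definition braid_monoid :: "nat \<Rightarrow> nat list set monoid" where
  "braid_monoid n =
     \<lparr>carrier = lists {1..<n} // braid_cong n,
      mult = (\<lambda>X Y. \<Union>x\<in>X. \<Union>y\<in>Y. braid_class n (x @ y)),
      one = braid_class n []\<rparr>"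

definition braid_gen :: "nat \<Rightarrow> nat \<Rightarrow> nat list set" where
  "braid_gen n i = braid_class n [i]"

lemma braid_cong_lists:
  assumes "(u, v) \<in> braid_cong n"
  shows "u \<in> lists {1..<n} \<and> v \<in> lists {1..<n}"
  using assms by (induction rule: braid_cong.induct) auto

lemma equiv_braid_cong: "equiv (lists {1..<n}) (braid_cong n)"
proof (rule equivI)
  show "braid_cong n \<subseteq> lists {1..<n} \<times> lists {1..<n}"
    by (rule subrelI) (use braid_cong_lists in \<open>simp only: mem_Times_iff fst_conv snd_conv\<close>)
  show "refl_on (lists {1..<n}) (braid_cong n)"
    by (auto simp: refl_on_def intro: braid_cong.refl)
  show "sym (braid_cong n)"
    by (rule symI) (rule braid_cong.sym)
  show "trans (braid_cong n)"
    by (rule transI) (rule braid_cong.trans)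
qed

lemma braid_class_eq_iff:
  assumes "u \<in> lists {1..<n}" "v \<in> lists {1..<n}"
  shows "braid_class n u = braid_class n v \<longleftrightarrow> (u, v) \<in> braid_cong n"
  unfolding braid_class_def by (rule eq_equiv_class_iff[OF equiv_braid_cong assms])

lemma carrier_braid_monoid: "carrier (braid_monoid n) = braid_class n ` lists {1..<n}"
  by (auto simp: braid_monoid_def quotient_def braid_class_def)

lemma mult_braid_class:
  assumes u: "u \<in> lists {1..<n}" and v: "v \<in> lists {1..<n}"
  shows "braid_class n u \<otimes>\<^bsub>braid_monoid n\<^esub> braid_class n v = braid_class n (u @ v)"
proof -
  have eq: "braid_class n (x @ y) = braid_class n (u @ v)"
    if "x \<in> braid_class n u" "y \<in> braid_class n v" for x y
  proof -
    have "(u @ v, x @ y) \<in> braid_cong n"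
      using that unfolding braid_class_def by (simp add: braid_cong.mult)
    then show ?thesis
      unfolding braid_class_def by (rule equiv_class_eq[OF equiv_braid_cong, symmetric])
  qed
  have "u \<in> braid_class n u" "v \<in> braid_class n v"
    using braid_cong.refl[OF u] braid_cong.refl[OF v] by (simp_all add: braid_class_def)
  then have "(\<Union>x\<in>braid_class n u. \<Union>y\<in>braid_class n v. braid_class n (x @ y)) =
      braid_class n (u @ v)"
    using eq by blast
  then show ?thesis
    by (simp add: braid_monoid_def)
qed

lemma one_braid_monoid: "\<one>\<^bsub>braid_monoid n\<^esub> = braid_class n []"
  by (simp add: braid_monoid_def)

lemma monoid_braid_monoid: "monoid (braid_monoid n)"
proof (rule monoidI)
  fix x y assume "x \<in> carrier (braid_monoid n)" "y \<in> carrier (braid_monoid n)"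
  then obtain u v where "u \<in> lists {1..<n}" "v \<in> lists {1..<n}"
    "x = braid_class n u" "y = braid_class n v"
    by (auto simp only: carrier_braid_monoid)
  then show "x \<otimes>\<^bsub>braid_monoid n\<^esub> y \<in> carrier (braid_monoid n)"
    by (simp add: mult_braid_class carrier_braid_monoid del: in_lists_conv_set)
next
  show "\<one>\<^bsub>braid_monoid n\<^esub> \<in> carrier (braid_monoid n)"
    by (simp add: one_braid_monoid carrier_braid_monoid)
next
  fix x y z
  assume "x \<in> carrier (braid_monoid n)" "y \<in> carrier (braid_monoid n)"
    "z \<in> carrier (braid_monoid n)"
  then obtain u v w where "u \<in> lists {1..<n}" "v \<in> lists {1..<n}" "w \<in> lists {1..<n}"
    "x = braid_class n u" "y = braid_class n v" "z = braid_class n w"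
    by (auto simp only: carrier_braid_monoid)
  then show "x \<otimes>\<^bsub>braid_monoid n\<^esub> y \<otimes>\<^bsub>braid_monoid n\<^esub> z =
      x \<otimes>\<^bsub>braid_monoid n\<^esub> (y \<otimes>\<^bsub>braid_monoid n\<^esub> z)"
    by (simp add: mult_braid_class del: in_lists_conv_set)
next
  fix x assume "x \<in> carrier (braid_monoid n)"
  then obtain u where u: "u \<in> lists {1..<n}" "x = braid_class n u"
    by (auto simp only: carrier_braid_monoid)
  then show "\<one>\<^bsub>braid_monoid n\<^esub> \<otimes>\<^bsub>braid_monoid n\<^esub> x = x"
    by (simp add: one_braid_monoid mult_braid_class del: in_lists_conv_set)
  from u show "x \<otimes>\<^bsub>braid_monoid n\<^esub> \<one>\<^bsub>braid_monoid n\<^esub> = x"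
    by (simp add: one_braid_monoid mult_braid_class del: in_lists_conv_set)
qed

text \<open>\<^const>\<open>hom\<close> does not require that the unit be preserved. The functions are extensional on
  the carrier, so that equality of homomorphisms is equality of functions.\<close>

definition monoid_homs :: "('a, 'c) monoid_scheme \<Rightarrow> ('b, 'd) monoid_scheme \<Rightarrow> ('a \<Rightarrow> 'b) set" where
  "monoid_homs G H =
     {h \<in> hom G H. h \<one>\<^bsub>G\<^esub> = \<one>\<^bsub>H\<^esub>} \<inter> extensional (carrier G)"


section \<open>Symmetric groups as Coxeter groups\<close>

abbreviation simple_refl :: "nat \<Rightarrow> nat \<Rightarrow> nat" where
  "simple_refl i \<equiv> Transposition.transpose i (Suc i)"

definition word_perm :: "nat list \<Rightarrow> nat \<Rightarrow> nat" where
  "word_perm ks = foldr (\<circ>) (map simple_refl ks) id"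

definition coxeter_length :: "nat \<Rightarrow> (nat \<Rightarrow> nat) \<Rightarrow> nat" where
  "coxeter_length n w = (LEAST l. \<exists>ks \<in> lists {1..<n}. length ks = l \<and> word_perm ks = w)"

definition reduced_word :: "nat \<Rightarrow> (nat \<Rightarrow> nat) \<Rightarrow> nat list \<Rightarrow> bool" where
  "reduced_word n w ks \<longleftrightarrow>
     ks \<in> lists {1..<n} \<and> word_perm ks = w \<and> length ks = coxeter_length n w"

text \<open>The element \<open>T\<^sub>w\<close>. By Matsumoto's theorem it does not depend on the choice of the
  reduced word.\<close>

definition braid_lift :: "nat \<Rightarrow> (nat \<Rightarrow> nat) \<Rightarrow> nat list set" where
  "braid_lift n w = braid_class n (SOME ks. reduced_word n w ks)"

definition parabolic :: "nat \<Rightarrow> nat set \<Rightarrow> (nat \<Rightarrow> nat) set" where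
  "parabolic n K = generate (sym_group n) (simple_refl ` K)"

text \<open>The longest element of a parabolic subgroup is unique, so that
  \<^const>\<open>arg_max\<close> involves no choice. The length may be taken in the whole group, as it
  agrees on the parabolic subgroup with the length with respect to its own simple generators.\<close>

definition longest_elt :: "nat \<Rightarrow> nat set \<Rightarrow> nat \<Rightarrow> nat" where
  "longest_elt n K = (ARG_MAX (coxeter_length n) w. w \<in> parabolic n K)"

end

theory Submission
  imports Defs
begin

text \<open>The inversion set of a permutation determines it, and its cardinality is the Coxeter length.
  This gives Matsumoto's theorem and shows that the longest element of the parabolic subgroup of
  \<open>K\<close> is the unique permutation whose inversions are the pairs of positions in a common \<open>K\<close>-block.

  Let \<open>X\<close>, \<open>Y\<close> be the half twists on \<open>[1, 2m - 1]\<close> and \<open>[m + 1, 3m - 1]\<close>, and \<open>P\<close>, \<open>Q\<close>, \<open>R\<close> those on \<open>J\<close>,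
  \<open>2m - J\<close>, \<open>2m + J\<close>. These last three commute, and \<open>P X = X Q\<close>, \<open>R X = X R\<close>, \<open>P Y = Y P\<close>, \<open>Q Y = Y R\<close>. So
  \<open>XR \<cdot> YP \<cdot> XR = XYX \<cdot> PQR\<close> and \<open>YP \<cdot> XR \<cdot> YP = YXY \<cdot> PQR\<close>, and the braid relation reduces to the case
  \<open>J = \<emptyset>\<close>. There \<open>X = C\<^sub>1 D\<^sub>1 D\<^sub>2\<close> and \<open>Y = C\<^sub>2 D\<^sub>2 D\<^sub>3\<close>, with \<open>D\<^sub>i\<close> the half twist on the \<open>i\<close>-th block of
  \<open>m\<close> strands and \<open>C\<^sub>i\<close> the crossing of the blocks \<open>i\<close> and \<open>i + 1\<close>; both \<open>XYX\<close> and \<open>YXY\<close> equal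
  \<open>\<Delta> D\<^sub>1 D\<^sub>2 D\<^sub>3\<close> with \<open>\<Delta> = C\<^sub>1 C\<^sub>2 X D\<^sub>3 = C\<^sub>2 C\<^sub>1 Y D\<^sub>1\<close> the half twist on all \<open>3m\<close> strands.\<close>

section \<open>Inversions\<close>

definition inversions :: "(nat \<Rightarrow> nat) \<Rightarrow> (nat \<times> nat) set" where
  "inversions w = {(i, j). i < j \<and> w j < w i}"

text \<open>These are the positive roots of the parabolic subgroup of \<open>K\<close>, a root being
  encoded by a pair of positions; \<open>{i..<j}\<close> lists the simple roots whose sum it
  is.\<close>

definition block_pairs :: "nat set \<Rightarrow> (nat \<times> nat) set" where
  "block_pairs K = {(i, j). i < j \<and> {i..<j} \<subseteq> K}"

lemma mem_inversions: "(i, j) \<in> inversions w \<longleftrightarrow> i < j \<and> w j < w i"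
  by (simp add: inversions_def)

lemma mem_block_pairs: "(i, j) \<in> block_pairs K \<longleftrightarrow> i < j \<and> {i..<j} \<subseteq> K"
  by (simp add: block_pairs_def)

lemma inversions_id [simp]: "inversions id = {}"
  by (auto simp: inversions_def)

lemma finite_block_pairs:
  assumes "finite K"
  shows "finite (block_pairs K)"
proof (rule finite_subset)
  show "block_pairs K \<subseteq> K \<times> Suc ` K"
  proof (rule subrelI)
    fix i j assume "(i, j) \<in> block_pairs K"
    then have "i < j" "{i..<j} \<subseteq> K" by (auto simp: mem_block_pairs)
    then have "i \<in> K" "j - 1 \<in> K" "j = Suc (j - 1)" by auto
    then show "(i, j) \<in> K \<times> Suc ` K" by blast
  qed
  show "finite (K \<times> Suc ` K)" using assms by simp
qed

text \<open>An increasing map of the naturals never falls below the identity. Applied to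
  \<open>f\<close> and to its inverse, this bounds \<open>f x\<close> by \<open>x\<close> from both
  sides.\<close>

lemma strict_mono_bij_nat_id:
  fixes f :: "nat \<Rightarrow> nat"
  assumes "strict_mono f" "bij f"
  shows "f = id"
proof -
  have "inv_into UNIV f (f x) \<ge> f x" for x
  proof -
    have "strict_mono (inv_into UNIV f)"
      using assms by (metis bij_is_surj bij_is_inj inv_f_f strict_mono_inv surj_f_inv_f)
    then show ?thesis by (rule strict_mono_imp_increasing)
  qed
  moreover have "f x \<ge> x" for x using assms(1) by (rule strict_mono_imp_increasing)
  ultimately show ?thesis
    using assms(2) by (metis antisym bij_is_inj eq_id_iff inv_f_f)
qed

text \<open>With equal inversion sets, \<open>v\<close> and \<open>w\<close> order all positions
  alike, so \<open>v\<close> composed with the inverse of \<open>w\<close> is an increasing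
  bijection of the naturals.\<close>

lemma inversions_inject:
  assumes "bij v" "bij w" "inversions v = inversions w"
  shows "v = w"
proof -
  have less: "v i < v j \<longleftrightarrow> w i < w j" for i j
  proof -
    have inj: "inj v" "inj w" using assms by (auto simp: bij_def)
    consider "i = j" | "i < j" | "j < i" by linarith
    then show ?thesis
    proof cases
      case 2
      then have "v j < v i \<longleftrightarrow> w j < w i" using assms(3) by (metis mem_inversions)
      moreover have "v i \<noteq> v j" "w i \<noteq> w j" using 2 inj by (auto dest: injD)
      ultimately show ?thesis by linarith
    next
      case 3
      then show ?thesis using assms(3) by (metis mem_inversions)
    qed simp
  qed
  have "strict_mono (v \<circ> inv_into UNIV w)"
    using less assms(2) by (intro strict_monoI) (simp add: bij_is_surj surj_f_inv_f)
  moreover have "bij (v \<circ> inv_into UNIV w)"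
    using assms bij_comp bij_imp_bij_inv by blast
  ultimately have "v \<circ> inv_into UNIV w = id" by (rule strict_mono_bij_nat_id)
  then show ?thesis
    using assms(2) by (metis bij_is_inj comp_assoc comp_id id_comp inv_o_cancel)
qed

lemma bij_simple_refl [simp]: "bij (simple_refl k)"
  by simp

lemma simple_refl_less_iff:
  assumes "i < j" "(i, j) \<noteq> (k, Suc k)"
  shows "simple_refl k i < simple_refl k j"
  using assms by (auto simp: transpose_def)

text \<open>Relabelling positions by \<open>simple_refl k\<close> keeps the order of every pair
  except \<open>(k, Suc k)\<close>, and the ascent of \<open>w\<close> turns this one pair into an
  inversion.\<close>

lemma inversions_comp_simple_refl:
  assumes "w k < w (Suc k)"
  shows "inversions (w \<circ> simple_refl k) =
    insert (k, Suc k) (map_prod (simple_refl k) (simple_refl k) ` inversions w)" (is "?L = ?R")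
proof -
  let ?s = "simple_refl k"
  have eq: "(i, j) \<in> ?L \<longleftrightarrow> (i, j) \<in> ?R" for i j
  proof -
    have *: "(i, j) \<in> map_prod ?s ?s ` inversions w \<longleftrightarrow> (?s i, ?s j) \<in> inversions w"
    proof
      assume "(?s i, ?s j) \<in> inversions w"
      then have "map_prod ?s ?s (?s i, ?s j) \<in> map_prod ?s ?s ` inversions w" by (rule imageI)
      then show "(i, j) \<in> map_prod ?s ?s ` inversions w" by simp
    qed auto
    show ?thesis
    proof (cases "(i, j) = (k, Suc k)")
      case True
      then show ?thesis using assms by (simp add: mem_inversions)
    next
      case False
      have "i < j \<longleftrightarrow> ?s i < ?s j" if "w (?s j) < w (?s i)"
      proof (cases "i < j")
        case True then show ?thesis using simple_refl_less_iff False by blast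
      next
        case False
        \<comment> \<open>Otherwise a second application of \<open>?s\<close> would give
          \<open>i < j\<close>, unless \<open>(?s i, ?s j)\<close> is \<open>(k, Suc k)\<close>; but
          then \<open>w (?s j) < w (?s i)\<close> contradicts the ascent.\<close>
        then have "\<not> ?s i < ?s j"
          using simple_refl_less_iff[of "?s i" "?s j" k] that assms
          by (metis not_less_iff_gr_or_eq prod.inject transpose_involutory)
        then show ?thesis using False by simp
      qed
      then show ?thesis using * False by (auto simp: mem_inversions)
    qed
  qed
  show ?thesis by (intro subset_antisym subrelI) (simp_all only: eq)
qed

lemma card_inversions_ascent:
  assumes "w k < w (Suc k)" "finite (inversions w)"
  shows "finite (inversions (w \<circ> simple_refl k))"
    and "card (inversions (w \<circ> simple_refl k)) = Suc (card (inversions w))"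
proof -
  let ?f = "map_prod (simple_refl k) (simple_refl k)"
  have "(k, Suc k) \<notin> ?f ` inversions w"
    using assms(1) by (auto simp: mem_inversions transpose_def split: if_splits)
  moreover have "inj ?f" by (intro prod.inj_map) simp_all
  ultimately show "finite (inversions (w \<circ> simple_refl k))"
    "card (inversions (w \<circ> simple_refl k)) = Suc (card (inversions w))"
    using assms by (simp_all add: inversions_comp_simple_refl card_image inj_on_subset)
qed

lemma comp_simple_refl_cancel [simp]: "w \<circ> simple_refl k \<circ> simple_refl k = w"
  by (simp add: comp_assoc)

lemma card_inversions_descent:
  assumes "w (Suc k) < w k" "finite (inversions w)"
  shows "finite (inversions (w \<circ> simple_refl k))"
    and "card (inversions w) = Suc (card (inversions (w \<circ> simple_refl k)))"
proof -
  let ?v = "w \<circ> simple_refl k"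
  have *: "?v k < ?v (Suc k)" using assms by simp
  have w: "w = ?v \<circ> simple_refl k" by simp
  let ?f = "map_prod (simple_refl k) (simple_refl k)"
  have "inversions w = insert (k, Suc k) (?f ` inversions ?v)"
    using inversions_comp_simple_refl[OF *] unfolding comp_simple_refl_cancel .
  moreover have "inj ?f" by (intro prod.inj_map) simp_all
  ultimately show fin: "finite (inversions ?v)"
    using assms(2) by (metis finite_imageD finite_insert inj_on_subset subset_UNIV)
  show "card (inversions w) = Suc (card (inversions ?v))"
    using card_inversions_ascent(2)[OF * fin] unfolding comp_simple_refl_cancel .
qed

lemma inversions_comp_subset_block_pairs:
  assumes "inversions w \<subseteq> block_pairs K" "k \<in> K" "inj w"
  shows "inversions (w \<circ> simple_refl k) \<subseteq> block_pairs K"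
proof (rule subrelI)
  let ?s = "simple_refl k"
  fix i j assume ij: "(i, j) \<in> inversions (w \<circ> ?s)"
  show "(i, j) \<in> block_pairs K"
  proof (cases "(i, j) = (k, Suc k)")
    case True
    then show ?thesis using assms(2) by (auto simp: mem_block_pairs)
  next
    case False
    then have "?s i < ?s j" using ij simple_refl_less_iff by (auto simp: mem_inversions)
    then have "(?s i, ?s j) \<in> block_pairs K" using ij assms(1) by (auto simp: mem_inversions)
    then have sub: "{?s i..<?s j} \<subseteq> K" by (simp add: mem_block_pairs)
    have "i < j" using ij by (simp add: mem_inversions)
    \<comment> \<open>The swap moves an end of the interval at most across the letter
      \<open>k\<close>.\<close>
    moreover have "{i..<j} \<subseteq> insert k {?s i..<?s j}"
      by (auto simp: transpose_def)
    ultimately show ?thesis using sub assms(2) by (auto simp: mem_block_pairs)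
  qed
qed

section \<open>Permutations represented by words\<close>

lemma word_perm_simps [simp]:
  "word_perm [] = id"
  "word_perm (k # ks) = simple_refl k \<circ> word_perm ks"
  by (simp_all add: word_perm_def)

lemma word_perm_append [simp]: "word_perm (us @ vs) = word_perm us \<circ> word_perm vs"
  by (induction us) (simp_all add: comp_assoc)

lemma bij_word_perm [simp]: "bij (word_perm ks)"
  by (induction ks) (simp_all only: word_perm_simps bij_id bij_comp bij_simple_refl)

lemma inj_word_perm [simp]: "inj (word_perm ks)"
  by (simp add: bij_is_inj)

lemma inversions_word_perm:
  assumes "ks \<in> lists K"
  shows "inversions (word_perm ks) \<subseteq> block_pairs K"
  using assms
proof (induction ks rule: rev_induct)
  case (snoc k ks)
  have "inversions (word_perm ks \<circ> simple_refl k) \<subseteq> block_pairs K"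
    using snoc by (intro inversions_comp_subset_block_pairs) simp_all
  then show ?case by (simp only: word_perm_append word_perm_simps comp_id)
qed simp

lemma finite_inversions_word_perm [simp]: "finite (inversions (word_perm ks))"
  by (rule finite_subset[OF inversions_word_perm[of _ "set ks"]]) (auto simp: finite_block_pairs)

lemma card_inversions_word_perm: "card (inversions (word_perm ks)) \<le> length ks"
proof (induction ks rule: rev_induct)
  case (snoc k ks)
  let ?w = "word_perm ks"
  have "?w k \<noteq> ?w (Suc k)" using injD[OF inj_word_perm, of ks k "Suc k"] by auto
  then consider "?w k < ?w (Suc k)" | "?w (Suc k) < ?w k" by linarith
  then have "card (inversions (?w \<circ> simple_refl k)) \<le> Suc (length ks)"
    by cases (use card_inversions_ascent(2)[of ?w k] card_inversions_descent(2)[of ?w k] snoc in simp_all)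
  then show ?case by (simp only: word_perm_append word_perm_simps comp_id length_append_singleton)
qed (simp only: word_perm_simps inversions_id card.empty list.size)

text \<open>Sorting: strip descents from the right until none is left.\<close>

lemma word_of_inversions:
  assumes "bij w" "inversions w \<subseteq> block_pairs K" "finite (inversions w)"
  obtains ks where "ks \<in> lists K" "word_perm ks = w" "length ks = card (inversions w)"
proof -
  have "\<exists>ks\<in>lists K. word_perm ks = w \<and> length ks = card (inversions w)"
    using assms
  proof (induction "card (inversions w)" arbitrary: w)
    case 0
    then have "inversions w = {}" by simp
    then have "w = id" using inversions_inject[of w id] 0 by simp
    then show ?case using 0 by (intro bexI[of _ "[]"]) (simp_all only: word_perm_simps list.size lists.Nil)
  next
    case (Suc l)
    have "\<exists>k. w (Suc k) < w k"
    proof (rule ccontr)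
      assume "\<not> ?thesis"
      then have "mono w" by (simp add: mono_iff_le_Suc not_less)
      then have "\<not> w j < w i" if "i < j" for i j using that by (simp add: monoD not_less)
      then have "inversions w = {}" by (auto simp: inversions_def)
      then show False using Suc.hyps(2) by simp
    qed
    then obtain k where k: "w (Suc k) < w k" by blast
    let ?v = "w \<circ> simple_refl k"
    \<comment> \<open>A descent is itself an inversion, so the stripped letter belongs to
      \<open>K\<close> and the resulting word stays inside the parabolic subgroup.\<close>
    have "(k, Suc k) \<in> block_pairs K" using k Suc.prems by (auto simp: mem_inversions)
    then have kK: "k \<in> K" by (auto simp: mem_block_pairs)
    note desc = card_inversions_descent[OF k Suc.prems(3)]
    have "\<exists>ks\<in>lists K. word_perm ks = ?v \<and> length ks = card (inversions ?v)"
    proof (rule Suc.hyps(1))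
      show "bij ?v" using Suc.prems(1) bij_comp bij_simple_refl by blast
      then show "inversions ?v \<subseteq> block_pairs K"
        using inversions_comp_subset_block_pairs Suc.prems kK bij_is_inj by blast
    qed (use desc Suc.hyps(2) in simp_all)
    then obtain ks where ks: "ks \<in> lists K" "word_perm ks = ?v" "length ks = card (inversions ?v)"
      by blast
    show ?case
      by (rule bexI[of _ "ks @ [k]"]) (use ks kK desc in simp_all)
  qed
  then show ?thesis using that by blast
qed

section \<open>Reduced words and Matsumoto's theorem\<close>

text \<open>Sorting attains this length, and no word is shorter because each letter creates at most
  one inversion.\<close>

lemma coxeter_length_eq:
  assumes "bij w" "inversions w \<subseteq> block_pairs {1..<n}"
  shows "coxeter_length n w = card (inversions w)"
  unfolding coxeter_length_def
proof (rule Least_equality)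
  have "finite (inversions w)" using assms(2) finite_block_pairs finite_subset by blast
  then show "\<exists>ks\<in>lists {1..<n}. length ks = card (inversions w) \<and> word_perm ks = w"
    using word_of_inversions[OF assms] by metis
qed (use card_inversions_word_perm in auto)

lemma reduced_word_iff:
  "reduced_word n w ks \<longleftrightarrow>
     ks \<in> lists {1..<n} \<and> word_perm ks = w \<and> length ks = card (inversions w)"
  unfolding reduced_word_def
  using coxeter_length_eq[OF bij_word_perm inversions_word_perm, of ks n] by metis

lemma braid_cong_append_left:
  "x \<in> lists {1..<n} \<Longrightarrow> (u, v) \<in> braid_cong n \<Longrightarrow> (x @ u, x @ v) \<in> braid_cong n"
  by (intro braid_cong.mult braid_cong.refl)

lemma braid_cong_append_right:
  "x \<in> lists {1..<n} \<Longrightarrow> (u, v) \<in> braid_cong n \<Longrightarrow> (u @ x, v @ x) \<in> braid_cong n"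
  by (intro braid_cong.mult braid_cong.refl)

lemma braid_cong_word_perm:
  assumes "(u, v) \<in> braid_cong n"
  shows "word_perm u = word_perm v"
  using assms
proof (induction rule: braid_cong.induct)
  case (comm i j)
  then show ?case by (auto simp: fun_eq_iff transpose_def)
next
  case (braid i j)
  then have "j = Suc i \<or> i = Suc j" by auto
  then show ?case by (auto simp: fun_eq_iff transpose_def)
qed simp_all

text \<open>The last letters \<open>i\<close> and \<open>j\<close> of the two words are descents of \<open>w\<close>. Hence \<open>w\<close> also has a reduced
  word ending in the longest element of \<open>\<langle>s\<^sub>i, s\<^sub>j\<rangle>\<close>, which one relation turns
  from a word ending in \<open>i\<close> into one ending in \<open>j\<close>.\<close>

lemma matsumoto:
  assumes "reduced_word n w us" "reduced_word n w vs"
  shows "(us, vs) \<in> braid_cong n"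
  using assms
proof (induction "length us" arbitrary: w us vs rule: less_induct)
  case less
  have us: "us \<in> lists {1..<n}" "word_perm us = w" "length us = card (inversions w)"
    and vs: "vs \<in> lists {1..<n}" "word_perm vs = w" "length vs = card (inversions w)"
    using less.prems by (auto simp: reduced_word_iff)
  have bij_w: "bij w" and fin: "finite (inversions w)"
    using us(2) bij_word_perm finite_inversions_word_perm by blast+
  have sub: "inversions w \<subseteq> block_pairs {1..<n}"
    using us(1,2) inversions_word_perm by blast
  have IH: "(x, y) \<in> braid_cong n"
    if "x \<in> lists {1..<n}" "y \<in> lists {1..<n}" "word_perm x = word_perm y"
      "length x = length y" "length x = card (inversions (word_perm x))" "length x < length us" for x y
    using less.hyps[of x "word_perm x" y] that by (simp add: reduced_word_iff)
  \<comment> \<open>Otherwise \<open>k\<close> is a descent of \<open>word_perm x\<close>, which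
    then has one inversion more than \<open>w\<close> and hence more inversions than
    \<open>x\<close> has letters.\<close>
  have last_descent: "w (Suc k) < w k"
    if "w = word_perm x \<circ> simple_refl k" "Suc (length x) = card (inversions w)" for x k
  proof (rule ccontr)
    assume "\<not> w (Suc k) < w k"
    then have "\<not> word_perm x k < word_perm x (Suc k)" using that by simp
    moreover have "word_perm x k \<noteq> word_perm x (Suc k)"
      using injD[OF inj_word_perm, of x k "Suc k"] by auto
    ultimately have "word_perm x (Suc k) < word_perm x k" by linarith
    from card_inversions_descent(2)[OF this] that card_inversions_word_perm[of x]
    show False by simp
  qed
  show ?case
  proof (cases us rule: rev_cases)
    case Nil
    then show ?thesis using us vs by (auto intro: braid_cong.refl)
  next
    case us_eq: (snoc us' i)
    then obtain vs' j where vs_eq: "vs = vs' @ [j]"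
      using us(3) vs(3) by (cases vs rule: rev_cases) auto
    have ij: "i \<in> {1..<n}" "j \<in> {1..<n}" and us': "us' \<in> lists {1..<n}" and vs': "vs' \<in> lists {1..<n}"
      using us(1) vs(1) us_eq vs_eq by auto
    have wi: "w = word_perm us' \<circ> simple_refl i" and wj: "w = word_perm vs' \<circ> simple_refl j"
      using us(2) vs(2) us_eq vs_eq by auto
    have wi': "word_perm us' = w \<circ> simple_refl i" and wj': "word_perm vs' = w \<circ> simple_refl j"
      by (metis comp_simple_refl_cancel wi) (metis comp_simple_refl_cancel wj)
    have di: "w (Suc i) < w i" and dj: "w (Suc j) < w j"
      using last_descent[OF wi] last_descent[OF wj] us(3) vs(3) us_eq vs_eq by simp_all
    note ci = card_inversions_descent[OF di fin] and cj = card_inversions_descent[OF dj fin]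
    \<comment> \<open>By induction \<open>us'\<close> and \<open>vs'\<close> may be replaced by any
      words of the same lengths for the same permutations, so it suffices to link one such pair
      after the last letters are appended.\<close>
    have step: ?thesis
      if x: "x \<in> lists {1..<n}" "y \<in> lists {1..<n}" "word_perm x = word_perm us'" "word_perm y = word_perm vs'"
        "length x = length us'" "length y = length vs'" "(x @ [i], y @ [j]) \<in> braid_cong n" for x y
    proof -
      have "(us', x) \<in> braid_cong n" "(y, vs') \<in> braid_cong n"
        by (rule IH; use x us' vs' us(3) vs(3) us_eq vs_eq wi' wj' ci cj in simp)+
      then have "(us, x @ [i]) \<in> braid_cong n" "(y @ [j], vs) \<in> braid_cong n"
        unfolding us_eq vs_eq using ij by (auto intro!: braid_cong_append_right)
      then show ?thesis using x(7) braid_cong.trans by blast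
    qed
    consider "i = j" | "\<bar>int i - int j\<bar> > 1" | "\<bar>int i - int j\<bar> = 1" by linarith
    then show ?thesis
    proof cases
      case 1
      show ?thesis
        by (rule step[of us' us'])
          (use 1 ij us' wi' wj' us(3) vs(3) us_eq vs_eq in \<open>simp_all add: braid_cong.refl\<close>)
    next
      case 2
      let ?v = "w \<circ> simple_refl i \<circ> simple_refl j"
      \<comment> \<open>The two letters move disjoint positions, so \<open>j\<close> is still a
        descent once \<open>i\<close> is removed.\<close>
      have "(w \<circ> simple_refl i) (Suc j) < (w \<circ> simple_refl i) j"
        using 2 dj by (auto simp: transpose_def)
      note cv = card_inversions_descent[OF this ci(1)]
      have "bij ?v" using bij_w by (intro bij_comp) simp_all
      moreover have "inversions ?v \<subseteq> block_pairs {1..<n}"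
        by (intro inversions_comp_subset_block_pairs sub ij inj_compose)
          (use bij_w in \<open>simp_all add: bij_is_inj\<close>)
      ultimately obtain z where z: "z \<in> lists {1..<n}" "word_perm z = ?v" "length z = card (inversions ?v)"
        using word_of_inversions cv(1) by metis
      have comm: "simple_refl i \<circ> simple_refl j = simple_refl j \<circ> simple_refl i"
        using braid_cong_word_perm[OF braid_cong.comm[OF ij 2]] by simp
      show ?thesis
      proof (rule step[of "z @ [j]" "z @ [i]"])
        show "word_perm (z @ [i]) = word_perm vs'"
          using z(2) wj' comm by (simp add: comp_assoc)
        have "(z @ [j, i], z @ [i, j]) \<in> braid_cong n"
          using z(1) ij 2 by (intro braid_cong_append_left braid_cong.comm) auto
        then show "((z @ [j]) @ [i], (z @ [i]) @ [j]) \<in> braid_cong n" by simp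
      qed (use z ij wi' us us_eq vs vs_eq cv ci in simp_all)
    next
      case 3
      let ?v = "w \<circ> simple_refl i \<circ> simple_refl j \<circ> simple_refl i"
      have ji: "j = Suc i \<or> i = Suc j" using 3 by auto
      \<comment> \<open>The descents at the adjacent letters make \<open>w\<close> decreasing on
        three consecutive positions, so three descents can be removed in turn.\<close>
      have "(w \<circ> simple_refl i) (Suc j) < (w \<circ> simple_refl i) j"
        using ji di dj by (auto simp: transpose_def)
      note c1 = card_inversions_descent[OF this ci(1)]
      have "(w \<circ> simple_refl i \<circ> simple_refl j) (Suc i) < (w \<circ> simple_refl i \<circ> simple_refl j) i"
        using ji di dj by (auto simp: transpose_def)
      note cv = card_inversions_descent[OF this c1(1)]
      have "bij ?v" using bij_w by (intro bij_comp) simp_all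
      moreover have "inversions ?v \<subseteq> block_pairs {1..<n}"
        by (intro inversions_comp_subset_block_pairs sub ij inj_compose)
          (use bij_w in \<open>simp_all add: bij_is_inj\<close>)
      ultimately obtain z where z: "z \<in> lists {1..<n}" "word_perm z = ?v" "length z = card (inversions ?v)"
        using word_of_inversions cv(1) by metis
      have br: "simple_refl i \<circ> simple_refl j \<circ> simple_refl i = simple_refl j \<circ> simple_refl i \<circ> simple_refl j"
        using braid_cong_word_perm[OF braid_cong.braid[OF ij 3]] by (simp add: comp_assoc)
      have v: "?v = w \<circ> simple_refl j \<circ> simple_refl i \<circ> simple_refl j"
        using br by (simp add: comp_assoc)
      show ?thesis
      proof (rule step[of "z @ [i, j]" "z @ [j, i]"])
        show "word_perm (z @ [j, i]) = word_perm vs'"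
          using z(2) v wj' by (simp flip: comp_assoc)
        show "word_perm (z @ [i, j]) = word_perm us'"
          using z(2) wi' by (simp flip: comp_assoc)
        have "(z @ [i, j, i], z @ [j, i, j]) \<in> braid_cong n"
          using z(1) ij 3 by (intro braid_cong_append_left braid_cong.braid) auto
        then show "((z @ [i, j]) @ [i], (z @ [j, i]) @ [j]) \<in> braid_cong n" by simp
      qed (use z ij wi' us us_eq vs vs_eq c1 cv ci in simp_all)
    qed
  qed
qed

section \<open>Half twists\<close>

text \<open>A reduced word of the longest element of the parabolic subgroup of \<open>K\<close>,
  described through inversions so that neither the number of strands nor a maximum enters.\<close>

definition half_twist :: "nat set \<Rightarrow> nat list \<Rightarrow> bool" where
  "half_twist K u \<longleftrightarrow>
     u \<in> lists K \<and> inversions (word_perm u) = block_pairs K \<and> length u = card (block_pairs K)"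

text \<open>Descents at all letters of an interval make \<open>w\<close> strictly decreasing along
  it.\<close>

lemma block_pairs_subset_inversions:
  assumes "\<And>k. k \<in> K \<Longrightarrow> w (Suc k) < w k"
  shows "block_pairs K \<subseteq> inversions w"
proof (rule subrelI)
  fix i j assume "(i, j) \<in> block_pairs K"
  then have "i < j" "{i..<j} \<subseteq> K" by (auto simp: mem_block_pairs)
  then have "w j < w i"
  proof (induction j rule: nat_less_induct)
    case (1 j)
    then obtain l where l: "j = Suc l" "i \<le> l" by (cases j) auto
    then have "l \<in> K" using 1 by auto
    then have "w j < w l" using assms l by auto
    moreover have "w l \<le> w i"
    proof (cases "i = l")
      case False
      moreover have "{i..<l} \<subseteq> K" using 1(3) l by auto
      ultimately show ?thesis using 1(1) l by (simp add: less_imp_le)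
    qed simp
    ultimately show ?case by simp
  qed
  then show "(i, j) \<in> inversions w" using \<open>i < j\<close> by (simp add: mem_inversions)
qed

text \<open>A word over \<open>K\<close> has its inversions in \<open>block_pairs K\<close> anyway,
  so apart from the length only the descents at single letters have to be checked.\<close>

lemma half_twistI:
  assumes "u \<in> lists K" "\<And>k. k \<in> K \<Longrightarrow> word_perm u (Suc k) < word_perm u k"
    "length u = card (block_pairs K)"
  shows "half_twist K u"
  using assms block_pairs_subset_inversions[of K "word_perm u"] inversions_word_perm[of u K]
  unfolding half_twist_def by blast

lemma half_twist_descent:
  assumes "half_twist K u" "k \<in> K"
  shows "word_perm u (Suc k) < word_perm u k"
proof -
  have "(k, Suc k) \<in> inversions (word_perm u)"
    using assms by (auto simp: half_twist_def mem_block_pairs)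
  then show ?thesis by (simp add: mem_inversions)
qed

lemma half_twist_word_perm_eq:
  assumes "half_twist K u" "half_twist K v"
  shows "word_perm u = word_perm v"
  using assms inversions_inject[of "word_perm u" "word_perm v"] by (simp add: half_twist_def)

text \<open>Through Matsumoto's theorem, an identity of positive braids is reduced to an equality of
  permutations and a count of letters.\<close>

lemma braid_cong_half_twist:
  assumes "half_twist K u" "u \<in> lists {1..<n}" "v \<in> lists {1..<n}"
    "word_perm v = word_perm u" "length v = length u"
  shows "(v, u) \<in> braid_cong n"
  using assms by (intro matsumoto[of n "word_perm u"]) (simp_all add: reduced_word_iff half_twist_def)

section \<open>Longest elements of parabolic subgroups\<close>

lemma simple_refl_in_sym_group:
  assumes "k \<in> {1..<n}"
  shows "simple_refl k \<in> carrier (sym_group n)"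
  using assms by (simp add: sym_group_carrier permutes_swap_id)

text \<open>The generators are involutions, so inverses contribute nothing beyond products of
  generators.\<close>

lemma parabolic_eq:
  assumes "K \<subseteq> {1..<n}"
  shows "parabolic n K = word_perm ` lists K"
proof
  interpret G: group "sym_group n" by (rule sym_group_is_group)
  show "parabolic n K \<subseteq> word_perm ` lists K"
  proof
    fix w assume "w \<in> parabolic n K"
    then show "w \<in> word_perm ` lists K"
      unfolding parabolic_def
    proof (induction rule: generate.induct)
      case one
      show ?case by (rule image_eqI[of _ _ "[]"]) (simp_all add: sym_group_one)
    next
      case (incl h)
      then obtain k where "k \<in> K" "h = simple_refl k" by blast
      then show ?case by (intro image_eqI[of _ _ "[k]"]) simp_all
    next
      case (inv h)
      then obtain k where k: "k \<in> K" "h = simple_refl k" by blast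
      then have "h \<in> carrier (sym_group n)" using assms simple_refl_in_sym_group by blast
      moreover have "h \<otimes>\<^bsub>sym_group n\<^esub> h = \<one>\<^bsub>sym_group n\<^esub>"
        using k by (simp add: sym_group_mult sym_group_one)
      ultimately have "inv\<^bsub>sym_group n\<^esub> h = h" using G.inv_equality by blast
      then show ?case using k by (intro image_eqI[of _ _ "[k]"]) simp_all
    next
      case (eng h1 h2)
      then obtain u v where "u \<in> lists K" "v \<in> lists K" "h1 = word_perm u" "h2 = word_perm v"
        by blast
      then show ?case by (intro image_eqI[of _ _ "u @ v"]) (simp_all add: sym_group_mult)
    qed
  qed
  show "word_perm ` lists K \<subseteq> parabolic n K"
  proof
    fix w assume "w \<in> word_perm ` lists K"
    then obtain u where u: "u \<in> lists K" and w: "w = word_perm u" by blast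
    from u have "word_perm u \<in> parabolic n K"
    proof (induction u)
      case Nil
      then show ?case
        using generate.one[of "sym_group n" "simple_refl ` K"]
        by (simp only: parabolic_def word_perm_simps sym_group_one)
    next
      case (Cons k u)
      then have k: "k \<in> K" and u: "word_perm u \<in> generate (sym_group n) (simple_refl ` K)"
        by (simp_all only: parabolic_def)
      have "simple_refl k \<otimes>\<^bsub>sym_group n\<^esub> word_perm u \<in> generate (sym_group n) (simple_refl ` K)"
        using k by (intro generate.eng[OF generate.incl u] imageI)
      then show ?case by (simp only: parabolic_def word_perm_simps sym_group_mult)
    qed
    then show "w \<in> parabolic n K" using w by simp
  qed
qed

text \<open>At an element of maximal length no letter of \<open>K\<close> is an ascent, since
  appending it would stay in the subgroup and add an inversion. Descents at all letters of
  \<open>K\<close> then force every pair of \<open>block_pairs K\<close> to be inverted.\<close>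

lemma longest_elt:
  assumes K: "K \<subseteq> {1..<n}"
  shows "bij (longest_elt n K)" "inversions (longest_elt n K) = block_pairs K"
proof -
  let ?w = "longest_elt n K"
  have finK: "finite K" using K finite_subset by blast
  have sub: "block_pairs K \<subseteq> block_pairs {1..<n}"
    using K by (auto simp only: block_pairs_def)
  have len: "coxeter_length n (word_perm u) = card (inversions (word_perm u))" if "u \<in> lists K" for u
    using inversions_word_perm[OF that] sub by (intro coxeter_length_eq) auto
  \<comment> \<open>A bound on the lengths guarantees that the maximum in \<open>longest_elt\<close>
    is attained.\<close>
  have bound: "\<forall>v. v \<in> parabolic n K \<longrightarrow> coxeter_length n v < Suc (card (block_pairs K))"
  proof (intro allI impI)
    fix v assume "v \<in> parabolic n K"
    then obtain u where u: "u \<in> lists K" "v = word_perm u" using K by (auto simp only: parabolic_eq)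
    then show "coxeter_length n v < Suc (card (block_pairs K))"
      using len[OF u(1)] card_mono[OF finite_block_pairs[OF finK] inversions_word_perm[OF u(1)]] by simp
  qed
  have "id \<in> parabolic n K" using K
    by (auto simp only: parabolic_eq lists.Nil word_perm_simps intro!: image_eqI[of _ _ "[]"])
  from arg_max_nat_lemma[of "\<lambda>w. w \<in> parabolic n K", OF this bound]
  have w: "?w \<in> parabolic n K"
    and max: "\<And>v. v \<in> parabolic n K \<Longrightarrow> coxeter_length n v \<le> coxeter_length n ?w"
    unfolding longest_elt_def by blast+
  obtain u where u: "u \<in> lists K" "?w = word_perm u" using w K by (auto simp only: parabolic_eq)
  then show "bij ?w" by simp
  have "?w (Suc k) < ?w k" if "k \<in> K" for k
  proof (rule ccontr)
    assume "\<not> ?w (Suc k) < ?w k"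
    moreover have "word_perm u k \<noteq> word_perm u (Suc k)"
      using injD[OF inj_word_perm, of u k "Suc k"] by auto
    ultimately have "word_perm u k < word_perm u (Suc k)" using u by simp
    note asc = card_inversions_ascent(2)[OF this]
    have uk: "u @ [k] \<in> lists K" using u that by simp
    then have "coxeter_length n (word_perm (u @ [k])) \<le> coxeter_length n ?w"
      using max K by (simp only: parabolic_eq imageI)
    then show False using asc len[OF uk] len[OF u(1)] u(2) by simp
  qed
  then have "block_pairs K \<subseteq> inversions ?w" by (rule block_pairs_subset_inversions)
  then show "inversions ?w = block_pairs K" using u inversions_word_perm by auto
qed

lemma half_twist_exists:
  assumes "K \<subseteq> {1..<n}"
  obtains u where "half_twist K u" "word_perm u = longest_elt n K"
proof -
  have "finite (block_pairs K)" using assms finite_block_pairs finite_subset by blast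
  then obtain u where "u \<in> lists K" "word_perm u = longest_elt n K" "length u = card (block_pairs K)"
    using word_of_inversions[of "longest_elt n K" K] longest_elt[OF assms] by auto
  then show ?thesis using that longest_elt[OF assms] by (simp add: half_twist_def)
qed

text \<open>By Matsumoto's theorem the word chosen in \<open>braid_lift\<close> may be replaced by
  any half twist on \<open>K\<close>.\<close>

lemma braid_lift_longest_elt:
  assumes "K \<subseteq> {1..<n}" "half_twist K v"
  shows "braid_lift n (longest_elt n K) = braid_class n v"
proof -
  let ?w = "longest_elt n K"
  obtain u where u: "half_twist K u" "word_perm u = ?w" using half_twist_exists[OF assms(1)] .
  have v: "word_perm v = ?w" using half_twist_word_perm_eq[OF assms(2) u(1)] u(2) by simp
  have vl: "v \<in> lists {1..<n}" using assms lists_mono unfolding half_twist_def by blast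
  have red: "reduced_word n ?w v"
    using assms(2) v vl by (simp add: reduced_word_iff half_twist_def del: in_lists_conv_set)
  then have red': "reduced_word n ?w (SOME ks. reduced_word n ?w ks)" by (rule someI)
  then have "(SOME ks. reduced_word n ?w ks) \<in> lists {1..<n}" by (simp only: reduced_word_iff)
  then show ?thesis
    unfolding braid_lift_def using matsumoto[OF red' red] vl by (simp only: braid_class_eq_iff)
qed

section \<open>Distant and shifted blocks\<close>

lemma word_perm_fixes:
  assumes "ks \<in> lists K" "x \<notin> K" "x \<notin> Suc ` K"
  shows "word_perm ks x = x"
  using assms(1)
proof (induction ks)
  case (Cons k ks)
  then have "x \<noteq> k" "x \<noteq> Suc k" using assms by auto
  then show ?case using Cons by (simp add: transpose_def)
qed simp

lemma word_perm_stable: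
  assumes "ks \<in> lists K" "x \<in> K \<union> Suc ` K"
  shows "word_perm ks x \<in> K \<union> Suc ` K"
proof (rule ccontr)
  assume "word_perm ks x \<notin> K \<union> Suc ` K"
  then have "word_perm ks (word_perm ks x) = word_perm ks x"
    using word_perm_fixes[OF assms(1)] by blast
  then have "word_perm ks x = x" using injD[OF inj_word_perm] by blast
  then show False using \<open>word_perm ks x \<notin> _\<close> assms(2) by simp
qed

text \<open>Letters at distance at least two: the generators commute, and the positions moved by the
  two sets are disjoint.\<close>

definition far_apart :: "nat set \<Rightarrow> nat set \<Rightarrow> bool" where
  "far_apart K L \<longleftrightarrow> (\<forall>k\<in>K. \<forall>l\<in>L. Suc k < l \<or> Suc l < k)"

text \<open>An interval of letters cannot pass from one set to the other, because consecutive
  letters are too close.\<close>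

lemma block_pairs_Un_far_apart:
  assumes "far_apart K L"
  shows "block_pairs (K \<union> L) = block_pairs K \<union> block_pairs L" and "block_pairs K \<inter> block_pairs L = {}"
proof -
  have one: "{i..<j} \<subseteq> K" if far: "far_apart K L" and ij: "i \<in> K" "{i..<j} \<subseteq> K \<union> L"
    for i j and K L :: "nat set"
  proof
    fix x assume "x \<in> {i..<j}"
    then have "i \<le> x" "x < j" by auto
    then show "x \<in> K"
    proof (induction x rule: dec_induct)
      case (step x)
      then have "x \<in> K" "Suc x \<in> {i..<j}" by auto
      then have "Suc x \<in> K \<union> L" using ij by blast
      moreover have "Suc x \<notin> L"
      proof
        assume "Suc x \<in> L"
        then have "Suc x < Suc x \<or> Suc (Suc x) < x"
          using far \<open>x \<in> K\<close> unfolding far_apart_def by blast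
        then show False by simp
      qed
      ultimately show ?case by blast
    qed (use ij in simp)
  qed
  have far': "far_apart L K" using assms by (fastforce simp: far_apart_def)
  show "block_pairs (K \<union> L) = block_pairs K \<union> block_pairs L"
  proof (intro subset_antisym subrelI)
    fix i j assume "(i, j) \<in> block_pairs (K \<union> L)"
    then have ij: "i < j" "{i..<j} \<subseteq> K \<union> L" by (auto simp: mem_block_pairs)
    then have "i \<in> K \<or> i \<in> L" by auto
    then have "{i..<j} \<subseteq> K \<or> {i..<j} \<subseteq> L"
      using one[OF assms _ ij(2)] one[OF far', of i j] ij(2) by (auto simp only: Un_commute)
    then show "(i, j) \<in> block_pairs K \<union> block_pairs L" using ij by (auto simp: mem_block_pairs)
  qed (auto simp: mem_block_pairs)
  show "block_pairs K \<inter> block_pairs L = {}"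
  proof (rule ccontr)
    assume "\<not> ?thesis"
    then obtain i j where "(i, j) \<in> block_pairs K" "(i, j) \<in> block_pairs L" by auto
    then have "i \<in> K" "i \<in> L" by (auto simp: mem_block_pairs)
    then show False using assms by (fastforce simp: far_apart_def)
  qed
qed

text \<open>The two words move disjoint sets of positions, so the descents of each survive in the
  product.\<close>

lemma half_twist_append_far_apart:
  assumes "half_twist K u" "half_twist L v" and far: "far_apart K L" and fin: "finite K" "finite L"
  shows "half_twist (K \<union> L) (u @ v)"
proof (rule half_twistI)
  have u: "u \<in> lists K" and v: "v \<in> lists L" using assms by (simp_all add: half_twist_def)
  then show "u @ v \<in> lists (K \<union> L)" by auto
  show "length (u @ v) = card (block_pairs (K \<union> L))"
    using assms by (simp add: half_twist_def block_pairs_Un_far_apart[OF far] card_Un_disjoint finite_block_pairs)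
  have disj: "(K \<union> Suc ` K) \<inter> (L \<union> Suc ` L) = {}"
    using far by (force simp: far_apart_def)
  fix k assume "k \<in> K \<union> L"
  then show "word_perm (u @ v) (Suc k) < word_perm (u @ v) k"
  proof
    assume k: "k \<in> K"
    then have "k \<notin> L \<union> Suc ` L" "Suc k \<notin> L \<union> Suc ` L" using disj by blast+
    then have "word_perm v k = k" "word_perm v (Suc k) = Suc k"
      using word_perm_fixes[OF v] by blast+
    then show ?thesis using half_twist_descent[OF assms(1) k] by simp
  next
    assume k: "k \<in> L"
    then have "word_perm v k \<in> L \<union> Suc ` L" "word_perm v (Suc k) \<in> L \<union> Suc ` L"
      using word_perm_stable[OF v] by blast+
    then have "word_perm u (word_perm v k) = word_perm v k"
      "word_perm u (word_perm v (Suc k)) = word_perm v (Suc k)"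
      using word_perm_fixes[OF u] disj by blast+
    then show ?thesis using half_twist_descent[OF assms(2) k] by simp
  qed
qed

lemma word_perm_shift: "word_perm (map ((+) c) ks) (c + x) = c + word_perm ks x"
proof (induction ks arbitrary: x)
  case (Cons k ks)
  have "simple_refl (c + k) (c + y) = c + simple_refl k y" for y by (simp add: transpose_def)
  then show ?case using Cons by simp
qed simp

lemma block_pairs_shift: "block_pairs ((+) c ` K) = map_prod ((+) c) ((+) c) ` block_pairs K"
proof (intro subset_antisym subrelI)
  fix i j assume ij: "(i, j) \<in> block_pairs ((+) c ` K)"
  \<comment> \<open>The end \<open>j\<close> may lie just outside the shifted set; its predecessor
    lies inside, which is enough to subtract \<open>c\<close>.\<close>
  then have "i \<in> (+) c ` K" "j - 1 \<in> (+) c ` K" "i < j" by (auto simp: mem_block_pairs)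
  then obtain a b where ab: "i = c + a" "j = c + b"
    by (auto simp: image_iff) (metis add_Suc_right Suc_pred less_nat_zero_code neq0_conv)
  have "{a..<b} \<subseteq> K"
  proof
    fix x assume "x \<in> {a..<b}"
    then have "c + x \<in> {i..<j}" using ab by simp
    then show "x \<in> K" using ij by (auto simp: mem_block_pairs)
  qed
  then have "(a, b) \<in> block_pairs K" using ij ab by (auto simp: mem_block_pairs)
  then show "(i, j) \<in> map_prod ((+) c) ((+) c) ` block_pairs K" using ab by force
next
  fix i j assume "(i, j) \<in> map_prod ((+) c) ((+) c) ` block_pairs K"
  then obtain a b where ab: "i = c + a" "j = c + b" "a < b" "{a..<b} \<subseteq> K"
    by (auto simp: mem_block_pairs)
  have "{i..<j} = (+) c ` {a..<b}" unfolding ab(1,2) by (simp add: add.commute)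
  also have "\<dots> \<subseteq> (+) c ` K" using ab(4) by (rule image_mono)
  finally show "(i, j) \<in> block_pairs ((+) c ` K)" using ab by (simp add: mem_block_pairs)
qed

lemma half_twist_shift:
  assumes "half_twist K u"
  shows "half_twist ((+) c ` K) (map ((+) c) u)"
proof (rule half_twistI)
  show "map ((+) c) u \<in> lists ((+) c ` K)" using assms by (auto simp: half_twist_def)
  have "inj (map_prod ((+) c) ((+) c))" by (intro prod.inj_map) simp_all
  then show "length (map ((+) c) u) = card (block_pairs ((+) c ` K))"
    using assms by (simp add: half_twist_def block_pairs_shift card_image inj_on_subset)
  fix k assume "k \<in> (+) c ` K"
  then obtain a where a: "k = c + a" "Suc k = c + Suc a" "a \<in> K" by auto
  show "word_perm (map ((+) c) u) (Suc k) < word_perm (map ((+) c) u) k"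
    unfolding a(2) unfolding a(1) word_perm_shift using half_twist_descent[OF assms a(3)] by simp
qed

section \<open>Half twists on intervals as reversals\<close>

lemma word_perm_half_twist_interval:
  assumes "half_twist {a..<b} u"
  shows "word_perm u x = (if a \<le> x \<and> x \<le> b then a + b - x else x)"
proof -
  \<comment> \<open>The reversal of a block of positions has the required inversions. The position
    \<open>b\<close> takes part although it is not a letter, since the letter \<open>b - 1\<close>
    moves it.\<close>
  define r where "r x = (if a \<le> x \<and> x \<le> b then a + b - x else x)" for x
  have "r (r x) = x" for x by (auto simp: r_def)
  then have "bij r" by (intro involuntory_imp_bij)
  moreover have "inversions r = block_pairs {a..<b}"
    by (auto simp: inversions_def block_pairs_def r_def split: if_splits)
  ultimately have "word_perm u = r"
    using assms by (intro inversions_inject) (simp_all add: half_twist_def)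
  then show ?thesis by (simp add: r_def)
qed

text \<open>The \<open>k\<close> letters join \<open>k + 1\<close> positions; the induction adds the
  pairs that end at the new last position. Doubling avoids a division.\<close>

lemma card_block_pairs_interval: "2 * card (block_pairs {a..<a + k}) = k * Suc k"
proof (induction k)
  case 0
  show ?case by (auto simp: block_pairs_def)
next
  case (Suc k)
  let ?f = "\<lambda>i. (i, Suc (a + k))"
  have "block_pairs {a..<a + Suc k} = block_pairs {a..<a + k} \<union> ?f ` {a..a + k}"
    by (auto simp: block_pairs_def image_iff atLeastLessThan_subset_iff)
  moreover have "block_pairs {a..<a + k} \<inter> ?f ` {a..a + k} = {}"
    by (auto simp: block_pairs_def atLeastLessThan_subset_iff)
  moreover have "card (?f ` {a..a + k}) = Suc k"
    by (subst card_image) (auto simp: inj_on_def)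
  ultimately show ?case
    using Suc by (simp add: card_Un_disjoint finite_block_pairs)
qed

text \<open>Let \<open>v\<close> be a reduced word for the half twist with its descent
  \<open>i\<close> removed, and \<open>i'\<close> the mirror image of \<open>i\<close>. The reversal
  conjugates \<open>i\<close> to \<open>i'\<close>, so \<open>v i\<close> and \<open>i' v\<close>
  are both reduced words of the half twist, and \<open>u i = i' v i = i' u\<close> in the
  monoid.\<close>

lemma half_twist_interval_swap_letter:
  assumes u: "half_twist {a..<b} u" and ab: "1 \<le> a" "b \<le> n" and i: "i \<in> {a..<b}"
  shows "(u @ [i], (a + b - 1 - i) # u) \<in> braid_cong n"
proof -
  let ?w = "word_perm u" and ?i' = "a + b - 1 - i"
  have K: "{a..<b} \<subseteq> {1..<n}" using ab by auto
  then have KL: "lists {a..<b} \<subseteq> lists {1..<n}" by (rule lists_mono)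
  have ul: "u \<in> lists {a..<b}" using u by (simp add: half_twist_def)
  have i': "?i' \<in> {a..<b}" using i by auto
  \<comment> \<open>The positions \<open>i\<close> and \<open>Suc i\<close> go to
    \<open>a + b - i\<close> and \<open>a + b - 1 - i\<close>; the smaller of these is the
    letter.\<close>
  have conj: "?w \<circ> simple_refl i = simple_refl ?i' \<circ> ?w"
    using i by (auto simp: fun_eq_iff transpose_def word_perm_half_twist_interval[OF u])
  let ?v = "?w \<circ> simple_refl i"
  note desc = card_inversions_descent[OF half_twist_descent[OF u i] finite_inversions_word_perm]
  have "inversions ?v \<subseteq> block_pairs {a..<b}"
    using i ul by (intro inversions_comp_subset_block_pairs inversions_word_perm) simp_all
  moreover have "bij ?v" by (intro bij_comp) simp_all
  ultimately obtain v where v: "v \<in> lists {a..<b}" "word_perm v = ?v" "length v = card (inversions ?v)"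
    using word_of_inversions desc(1) by metis
  have len: "Suc (length v) = length u" using desc v(3) u by (simp add: half_twist_def)
  have "(v @ [i], u) \<in> braid_cong n"
  proof (rule braid_cong_half_twist[OF u])
    show "word_perm (v @ [i]) = ?w" using v(2) by simp
  qed (use v(1) ul i KL K len in auto)
  moreover have "(?i' # v, u) \<in> braid_cong n"
  proof (rule braid_cong_half_twist[OF u])
    have "simple_refl ?i' \<circ> (simple_refl ?i' \<circ> ?w) = ?w" by (simp flip: comp_assoc)
    then show "word_perm (?i' # v) = ?w" using v(2) conj by simp
  qed (use v(1) ul i' KL K len in auto)
  ultimately have 1: "(u, v @ [i]) \<in> braid_cong n" "(?i' # v, u) \<in> braid_cong n"
    by (blast intro: braid_cong.sym)+
  have "(?i' # v @ [i], ?i' # u) \<in> braid_cong n"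
    using braid_cong_append_left[OF _ braid_cong.sym[OF 1(1)], of "[?i']"] i' K by auto
  moreover have "(u @ [i], ?i' # v @ [i]) \<in> braid_cong n"
    using braid_cong_append_right[OF _ braid_cong.sym[OF 1(2)], of "[i]"] i K by auto
  ultimately show ?thesis using braid_cong.trans by blast
qed

lemma half_twist_interval_swap:
  assumes u: "half_twist {a..<b} u" and ab: "1 \<le> a" "b \<le> n" and p: "p \<in> lists {a..<b}"
  shows "(u @ p, map (\<lambda>i. a + b - 1 - i) p @ u) \<in> braid_cong n"
  using p
proof (induction p)
  case Nil
  have "u \<in> lists {a..<b}" using u by (simp add: half_twist_def)
  moreover have "{a..<b} \<subseteq> {1..<n}" using ab by auto
  ultimately have "u \<in> lists {1..<n}" using lists_mono by blast
  then show ?case by (simp add: braid_cong.refl del: in_lists_conv_set)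
next
  case (Cons i p)
  let ?f = "\<lambda>i. a + b - 1 - i"
  have sub: "{a..<b} \<subseteq> {1..<n}" using ab by auto
  have i: "i \<in> {a..<b}" and p: "p \<in> lists {a..<b}" using Cons by auto
  have "(u @ [i], ?f i # u) \<in> braid_cong n" by (rule half_twist_interval_swap_letter[OF u ab i])
  then have "((u @ [i]) @ p, (?f i # u) @ p) \<in> braid_cong n"
    using p sub by (intro braid_cong_append_right) auto
  moreover have "([?f i] @ (u @ p), [?f i] @ (map ?f p @ u)) \<in> braid_cong n"
    using i ab Cons by (intro braid_cong_append_left) auto
  ultimately show ?case using braid_cong.trans by simp
qed

text \<open>Letterwise swapping carries \<open>p\<close> to its mirror image. That word is congruent
  to \<open>q\<close>: conjugation by the reversal gives the right permutation, and blocks of equal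
  size give equal lengths.\<close>

lemma half_twist_interval_swap_half_twist:
  assumes u: "half_twist {a..<b} u" and ab: "1 \<le> a" "b \<le> n"
    and p: "half_twist {i..<j} p" and ij: "a \<le> i" "i \<le> j" "j \<le> b"
    and q: "half_twist {a + b - j..<a + b - i} q"
  shows "(u @ p, q @ u) \<in> braid_cong n"
proof -
  let ?f = "\<lambda>i. a + b - 1 - i"
  have sub: "{i..<j} \<subseteq> {a..<b}" "{a..<b} \<subseteq> {1..<n}" using ij ab by auto
  have qsub: "{a + b - j..<a + b - i} \<subseteq> {1..<n}" using ij ab by auto
  have ul: "u \<in> lists {a..<b}" and pl: "p \<in> lists {i..<j}"
    and ql: "q \<in> lists {a + b - j..<a + b - i}"
    using u p q by (simp_all add: half_twist_def)
  have swap: "(u @ p, map ?f p @ u) \<in> braid_cong n"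
    using pl sub by (intro half_twist_interval_swap[OF u ab]) auto
  have uu: "word_perm u (word_perm u x) = x" for x
    unfolding word_perm_half_twist_interval[OF u] by auto
  have "word_perm (map ?f p) = word_perm q"
  proof
    fix x
    have "word_perm (u @ p) = word_perm (map ?f p @ u)" by (rule braid_cong_word_perm[OF swap])
    then have "word_perm (map ?f p) (word_perm u y) = word_perm u (word_perm p y)" for y
      by (simp add: fun_eq_iff)
    \<comment> \<open>Since the reversal is an involution, this substitution isolates the mirrored
      word as a conjugate of \<open>word_perm p\<close>.\<close>
    from this[of "word_perm u x"]
    have "word_perm (map ?f p) x = word_perm u (word_perm p (word_perm u x))" by (simp add: uu)
    also have "\<dots> = word_perm q x"
    proof -
      note formula = word_perm_half_twist_interval[OF u] word_perm_half_twist_interval[OF p]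
        word_perm_half_twist_interval[OF q]
      consider "\<not> (a \<le> x \<and> x \<le> b)" | "a \<le> x" "x \<le> b" "\<not> (a + b - j \<le> x \<and> x \<le> a + b - i)"
        | "a \<le> x" "x \<le> b" "a + b - j \<le> x" "x \<le> a + b - i" by blast
      then show ?thesis
      proof cases
        case 1
        then have "word_perm u x = x" "word_perm p x = x" "word_perm q x = x"
          unfolding formula using ij by auto
        then show ?thesis by simp
      next
        case 2
        then have u_x: "word_perm u x = a + b - x" unfolding formula by simp
        have "word_perm p (a + b - x) = a + b - x" "word_perm q x = x" unfolding formula using 2 ij by auto
        moreover have "word_perm u (a + b - x) = x" unfolding formula using 2 by auto
        ultimately show ?thesis using u_x by simp
      next
        case 3
        then have u_x: "word_perm u x = a + b - x" unfolding formula by simp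
        moreover have "word_perm p (a + b - x) = i + j - (a + b - x)" unfolding formula using 3 ij by auto
        moreover have "word_perm u (i + j - (a + b - x)) = a + b - (i + j - (a + b - x))"
          unfolding formula using 3 ij by auto
        moreover have "word_perm q x = (a + b - j) + (a + b - i) - x" unfolding formula using 3 by simp
        ultimately show ?thesis using 3 ij by (simp add: ac_simps)
      qed
    qed
    finally show "word_perm (map ?f p) x = word_perm q x" .
  qed
  moreover have "length (map ?f p) = length q"
  proof -
    have "2 * length q = 2 * length p"
      using card_block_pairs_interval[of "a + b - j" "j - i"] card_block_pairs_interval[of i "j - i"]
        p q ij by (simp add: half_twist_def)
    then show ?thesis by simp
  qed
  ultimately have "(map ?f p, q) \<in> braid_cong n"
    using pl ql sub qsub by (intro braid_cong_half_twist[OF q]) (auto 0 3)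
  then have "(map ?f p @ u, q @ u) \<in> braid_cong n"
    using ul sub by (intro braid_cong_append_right) auto
  with swap show ?thesis by (rule braid_cong.trans)
qed

lemma braid_cong_far_apart:
  assumes "u \<in> lists K" "v \<in> lists L" "far_apart K L" "K \<subseteq> {1..<n}" "L \<subseteq> {1..<n}"
  shows "(u @ v, v @ u) \<in> braid_cong n"
proof -
  have letter: "(i # v, v @ [i]) \<in> braid_cong n" if "i \<in> K" for i
    using assms(2)
  proof (induction v)
    case Nil
    then show ?case using that assms(4) braid_cong.refl[of "[i]" n] by auto
  next
    case (Cons j v)
    have ij: "i \<in> {1..<n}" "j \<in> {1..<n}" "v \<in> lists {1..<n}" using that Cons assms(4,5) by auto
    have "Suc i < j \<or> Suc j < i" using assms(3) that Cons(1) unfolding far_apart_def by blast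
    then have "\<bar>int i - int j\<bar> > 1" by auto
    then have "([i, j] @ v, [j, i] @ v) \<in> braid_cong n"
      using ij by (intro braid_cong_append_right braid_cong.comm) auto
    moreover have "([j] @ (i # v), [j] @ (v @ [i])) \<in> braid_cong n"
      using ij Cons by (intro braid_cong_append_left) auto
    ultimately show ?case using braid_cong.trans by simp
  qed
  have vl: "v \<in> lists {1..<n}" using assms(2,5) by auto
  from assms(1) show ?thesis
  proof (induction u)
    case Nil
    then show ?case using vl by (auto intro: braid_cong.refl)
  next
    case (Cons i u)
    have iu: "i \<in> {1..<n}" "u \<in> lists {1..<n}" using Cons assms(4) by auto
    have "([i] @ (u @ v), [i] @ (v @ u)) \<in> braid_cong n"
      using iu Cons by (intro braid_cong_append_left) auto
    moreover have "((i # v) @ u, (v @ [i]) @ u) \<in> braid_cong n"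
      using iu letter Cons by (intro braid_cong_append_right) auto
    ultimately show ?case using braid_cong.trans by simp
  qed
qed

section \<open>Factoring a half twist out of a larger one\<close>

definition segment :: "nat \<Rightarrow> nat \<Rightarrow> nat set" where
  "segment x y = {min x y..<max x y}"

lemma segment_sym: "segment x y = segment y x"
  by (simp add: segment_def min.commute max.commute)

lemma segment_trans: "segment x z \<subseteq> segment x y \<union> segment y z"
  by (auto simp: segment_def)

text \<open>Each letter moves a position at most across itself, so a word over \<open>K\<close>
  never takes a position out of its block.\<close>

lemma segment_word_perm:
  assumes "ks \<in> lists K"
  shows "segment x (word_perm ks x) \<subseteq> K"
  using assms
proof (induction ks)
  case Nil
  then show ?case by (simp add: segment_def)
next
  case (Cons k ks)
  let ?y = "word_perm ks x"
  have "segment ?y (simple_refl k ?y) \<subseteq> K"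
    using Cons by (auto simp: segment_def transpose_def)
  moreover have "segment x ?y \<subseteq> K" using Cons by blast
  ultimately show ?case using segment_trans[of x "simple_refl k ?y" ?y] by auto
qed

text \<open>The word \<open>v\<close> permutes positions within the blocks of \<open>L\<close>, and
  \<open>u\<close> reverses the order of two positions exactly when they share a block. So the
  composite inverts precisely the pairs in a block that \<open>v\<close> leaves in order.\<close>

lemma inversions_half_twist_comp:
  assumes u: "half_twist L u" and v: "v \<in> lists L"
  shows "inversions (word_perm u \<circ> word_perm v) = block_pairs L - inversions (word_perm v)"
proof -
  have inv_u: "word_perm u b < word_perm u a \<longleftrightarrow> segment a b \<subseteq> L" if "a < b" for a b
  proof -
    have "(a, b) \<in> inversions (word_perm u) \<longleftrightarrow> (a, b) \<in> block_pairs L"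
      using u by (simp add: half_twist_def)
    then show ?thesis using that by (simp add: mem_inversions mem_block_pairs segment_def)
  qed
  have "(i, j) \<in> inversions (word_perm u \<circ> word_perm v) \<longleftrightarrow>
      (i, j) \<in> block_pairs L - inversions (word_perm v)" for i j
  proof (cases "i < j")
    case True
    let ?a = "word_perm v i" and ?b = "word_perm v j"
    have seg: "segment ?a ?b \<subseteq> L \<longleftrightarrow> segment i j \<subseteq> L"
      using segment_word_perm[OF v, of i] segment_word_perm[OF v, of j]
        segment_trans[of i j ?a] segment_trans[of ?a j ?b] segment_trans[of ?a ?b i]
        segment_trans[of i ?b j] segment_sym[of i ?a] segment_sym[of j ?b] by blast
    have block: "(i, j) \<in> block_pairs L \<longleftrightarrow> segment i j \<subseteq> L"
      using True by (simp add: mem_block_pairs segment_def)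
    have "(i, j) \<in> block_pairs L" if "?b < ?a"
      using that True inversions_word_perm[OF v] by (auto simp: mem_inversions)
    moreover have "?a \<noteq> ?b" using True injD[OF inj_word_perm, of v i j] by auto
    moreover have "word_perm u ?a \<noteq> word_perm u ?b"
      using \<open>?a \<noteq> ?b\<close> injD[OF inj_word_perm, of u ?a ?b] by auto
    ultimately show ?thesis
      using True seg block inv_u[of ?a ?b] inv_u[of ?b ?a] segment_sym[of ?a ?b]
      unfolding Diff_iff mem_inversions o_apply by (metis not_less_iff_gr_or_eq)
  qed (simp add: mem_inversions mem_block_pairs)
  then show ?thesis by (intro subset_antisym subrelI) blast+
qed

lemma half_twist_involution:
  assumes "half_twist K u"
  shows "word_perm u \<circ> word_perm u = id"
proof (rule inversions_inject)
  show "inversions (word_perm u \<circ> word_perm u) = inversions id"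
    using inversions_half_twist_comp[OF assms, of u] assms by (simp add: half_twist_def)
qed (simp_all add: bij_comp)

text \<open>The cofactor \<open>c\<close> represents the product of the two longest elements. Its
  inversions are those of \<open>u\<close> without those of \<open>v\<close>, so the lengths of
  \<open>c\<close> and \<open>v\<close> add up to that of \<open>u\<close>; since \<open>v\<close>
  is an involution, \<open>c @ v\<close> is another reduced word of the half twist on
  \<open>L\<close>.\<close>

lemma half_twist_factor:
  assumes u: "half_twist L u" and v: "half_twist K v" and sub: "K \<subseteq> L" "L \<subseteq> {1..<n}"
  obtains c where "c \<in> lists L" "word_perm c = word_perm u \<circ> word_perm v"
    "length c + card (block_pairs K) = card (block_pairs L)" "(u, c @ v) \<in> braid_cong n"
proof -
  let ?w = "word_perm u \<circ> word_perm v"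
  have vl: "v \<in> lists L" using v sub(1) by (auto simp: half_twist_def)
  have inv_w: "inversions ?w = block_pairs L - block_pairs K"
    using inversions_half_twist_comp[OF u vl] v by (simp add: half_twist_def)
  have fin: "finite (block_pairs L)" using sub(2) finite_block_pairs finite_subset by blast
  have bps: "block_pairs K \<subseteq> block_pairs L" using sub(1) by (auto simp: block_pairs_def)
  have "bij ?w" by (intro bij_comp) simp_all
  then obtain c where c: "c \<in> lists L" "word_perm c = ?w" "length c = card (inversions ?w)"
    using word_of_inversions[of ?w L] inv_w fin by auto
  have len: "length c + card (block_pairs K) = card (block_pairs L)"
    using c(3) inv_w fin bps card_mono[OF fin bps] by (simp add: card_Diff_subset finite_subset)
  have "(c @ v, u) \<in> braid_cong n"
  proof (rule braid_cong_half_twist[OF u])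
    show "word_perm (c @ v) = word_perm u"
      using c(2) half_twist_involution[OF v] by (simp add: comp_assoc)
  qed (use u v vl c sub len in \<open>auto simp: half_twist_def\<close>)
  then show ?thesis using that c len braid_cong.sym by blast
qed

lemma card_block_pairs_atLeastLessThan:
  assumes "a \<le> b"
  shows "2 * card (block_pairs {a..<b}) = (b - a) * Suc (b - a)"
  using card_block_pairs_interval[of a "b - a"] assms by simp

section \<open>The braid relation\<close>

context monoid
begin

text \<open>This form lets a commutation rule act inside a right-nested product, so that rewriting
  can push factors to the right.\<close>

lemma swap_left:
  assumes "a \<otimes> b = c \<otimes> d" "a \<in> carrier G" "b \<in> carrier G" "c \<in> carrier G" "d \<in> carrier G" "z \<in> carrier G"
  shows "a \<otimes> (b \<otimes> z) = c \<otimes> (d \<otimes> z)"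
  using assms by (simp flip: m_assoc)

text \<open>Expanding one factor at a time and pushing the \<open>d\<close>'s to the right brings
  both sides to the same shape; \<open>cc\<close> says that the remaining left parts are two
  factorizations of the full half twist.\<close>

lemma braid_relation_of_blocks:
  assumes [simp]: "x \<in> carrier G" "y \<in> carrier G" "c\<^sub>1 \<in> carrier G" "c\<^sub>2 \<in> carrier G"
      "d\<^sub>1 \<in> carrier G" "d\<^sub>2 \<in> carrier G" "d\<^sub>3 \<in> carrier G"
    and x: "x = c\<^sub>1 \<otimes> (d\<^sub>1 \<otimes> d\<^sub>2)" and y: "y = c\<^sub>2 \<otimes> (d\<^sub>2 \<otimes> d\<^sub>3)"
    and dx: "d\<^sub>1 \<otimes> x = x \<otimes> d\<^sub>2" "d\<^sub>2 \<otimes> x = x \<otimes> d\<^sub>1" "d\<^sub>3 \<otimes> x = x \<otimes> d\<^sub>3"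
    and dy: "d\<^sub>1 \<otimes> y = y \<otimes> d\<^sub>1" "d\<^sub>2 \<otimes> y = y \<otimes> d\<^sub>3" "d\<^sub>3 \<otimes> y = y \<otimes> d\<^sub>2"
    and dd: "d\<^sub>2 \<otimes> d\<^sub>1 = d\<^sub>1 \<otimes> d\<^sub>2" "d\<^sub>3 \<otimes> d\<^sub>1 = d\<^sub>1 \<otimes> d\<^sub>3" "d\<^sub>3 \<otimes> d\<^sub>2 = d\<^sub>2 \<otimes> d\<^sub>3"
    and cc: "c\<^sub>1 \<otimes> (c\<^sub>2 \<otimes> (x \<otimes> d\<^sub>3)) = c\<^sub>2 \<otimes> (c\<^sub>1 \<otimes> (y \<otimes> d\<^sub>1))"
  shows "x \<otimes> y \<otimes> x = y \<otimes> x \<otimes> y"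
proof -
  note sw = dx dy dd dx[THEN swap_left] dy[THEN swap_left] dd[THEN swap_left]
  have "x \<otimes> y \<otimes> x = c\<^sub>1 \<otimes> (d\<^sub>1 \<otimes> (d\<^sub>2 \<otimes> (y \<otimes> x)))"
    by (subst (1) x) (simp add: m_assoc)
  \<comment> \<open>Passing through \<open>y\<close> and then \<open>x\<close> turns
    \<open>d\<^sub>1 d\<^sub>2\<close> into \<open>d\<^sub>2 d\<^sub>3\<close> and brings
    \<open>y\<close> next to \<open>c\<^sub>1\<close>, where it is expanded.\<close>
  also have "\<dots> = c\<^sub>1 \<otimes> (y \<otimes> (x \<otimes> (d\<^sub>2 \<otimes> d\<^sub>3)))" by (simp add: sw)
  also have "\<dots> = c\<^sub>1 \<otimes> (c\<^sub>2 \<otimes> (d\<^sub>2 \<otimes> (d\<^sub>3 \<otimes> (x \<otimes> (d\<^sub>2 \<otimes> d\<^sub>3)))))"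
    by (subst (1) y) (simp add: m_assoc)
  also have "\<dots> = c\<^sub>1 \<otimes> (c\<^sub>2 \<otimes> (x \<otimes> d\<^sub>3)) \<otimes> (d\<^sub>1 \<otimes> (d\<^sub>2 \<otimes> d\<^sub>3))" by (simp add: sw m_assoc)
  finally have 1: "x \<otimes> y \<otimes> x = c\<^sub>1 \<otimes> (c\<^sub>2 \<otimes> (x \<otimes> d\<^sub>3)) \<otimes> (d\<^sub>1 \<otimes> (d\<^sub>2 \<otimes> d\<^sub>3))" .
  have "y \<otimes> x \<otimes> y = c\<^sub>2 \<otimes> (d\<^sub>2 \<otimes> (d\<^sub>3 \<otimes> (x \<otimes> y)))"
    by (subst (1) y) (simp add: m_assoc)
  also have "\<dots> = c\<^sub>2 \<otimes> (x \<otimes> (y \<otimes> (d\<^sub>1 \<otimes> d\<^sub>2)))" by (simp add: sw)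
  also have "\<dots> = c\<^sub>2 \<otimes> (c\<^sub>1 \<otimes> (d\<^sub>1 \<otimes> (d\<^sub>2 \<otimes> (y \<otimes> (d\<^sub>1 \<otimes> d\<^sub>2)))))"
    by (subst (1) x) (simp add: m_assoc)
  also have "\<dots> = c\<^sub>2 \<otimes> (c\<^sub>1 \<otimes> (y \<otimes> d\<^sub>1)) \<otimes> (d\<^sub>1 \<otimes> (d\<^sub>2 \<otimes> d\<^sub>3))" by (simp add: sw m_assoc)
  finally have 2: "y \<otimes> x \<otimes> y = c\<^sub>2 \<otimes> (c\<^sub>1 \<otimes> (y \<otimes> d\<^sub>1)) \<otimes> (d\<^sub>1 \<otimes> (d\<^sub>2 \<otimes> d\<^sub>3))" .
  show ?thesis unfolding 1 2 cc ..
qed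

text \<open>On either side the decorations can be moved to the right end, where each of
  \<open>p\<close>, \<open>q\<close>, \<open>r\<close> arrives exactly once.\<close>

lemma braid_relation_decorate:
  assumes [simp]: "x \<in> carrier G" "y \<in> carrier G" "p \<in> carrier G" "q \<in> carrier G" "r \<in> carrier G"
    and br: "x \<otimes> y \<otimes> x = y \<otimes> x \<otimes> y"
    and sx: "p \<otimes> x = x \<otimes> q" "q \<otimes> x = x \<otimes> p" "r \<otimes> x = x \<otimes> r"
    and sy: "p \<otimes> y = y \<otimes> p" "q \<otimes> y = y \<otimes> r" "r \<otimes> y = y \<otimes> q"
    and pqr: "q \<otimes> p = p \<otimes> q" "r \<otimes> p = p \<otimes> r" "r \<otimes> q = q \<otimes> r"
  shows "(x \<otimes> r) \<otimes> (y \<otimes> p) \<otimes> (x \<otimes> r) = (y \<otimes> p) \<otimes> (x \<otimes> r) \<otimes> (y \<otimes> p)"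
proof -
  note sw = sx sy pqr sx[THEN swap_left] sy[THEN swap_left] pqr[THEN swap_left]
  have "(x \<otimes> r) \<otimes> (y \<otimes> p) \<otimes> (x \<otimes> r) = x \<otimes> y \<otimes> x \<otimes> (p \<otimes> (q \<otimes> r))"
    by (simp add: m_assoc sw)
  moreover have "(y \<otimes> p) \<otimes> (x \<otimes> r) \<otimes> (y \<otimes> p) = y \<otimes> x \<otimes> y \<otimes> (p \<otimes> (q \<otimes> r))"
    by (simp add: m_assoc sw)
  ultimately show ?thesis using br by simp
qed

end

section \<open>Half twists on overlapping intervals\<close>

lemma braid_relation_overlapping_half_twists:
  assumes m: "m > 0" and x: "half_twist {1..<2 * m} x" and y: "half_twist {m + 1..<3 * m} y"
  shows "(x @ y @ x, y @ x @ y) \<in> braid_cong (3 * m)"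
proof -
  let ?n = "3 * m" and ?D\<^sub>1 = "{1..<m}" and ?D\<^sub>2 = "{m + 1..<2 * m}" and ?D\<^sub>3 = "{2 * m + 1..<3 * m}"
  let ?M = "braid_monoid ?n" and ?cl = "braid_class ?n"
  interpret M: monoid ?M by (rule monoid_braid_monoid)
  obtain d\<^sub>1 where d1: "half_twist ?D\<^sub>1 d\<^sub>1" using half_twist_exists[of ?D\<^sub>1 ?n] by auto
  obtain d\<^sub>2 where d2: "half_twist ?D\<^sub>2 d\<^sub>2" using half_twist_exists[of ?D\<^sub>2 ?n] by auto
  obtain d\<^sub>3 where d3: "half_twist ?D\<^sub>3 d\<^sub>3" using half_twist_exists[of ?D\<^sub>3 ?n] by auto
  obtain z where z: "half_twist {1..<3 * m} z" using half_twist_exists[of "{1..<3 * m}" ?n] by auto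
  have far: "far_apart ?D\<^sub>1 ?D\<^sub>2" "far_apart ?D\<^sub>1 ?D\<^sub>3" "far_apart ?D\<^sub>2 ?D\<^sub>3"
    "far_apart ?D\<^sub>1 {m + 1..<3 * m}" "far_apart {1..<2 * m} ?D\<^sub>3"
    by (auto simp: far_apart_def)
  have d12: "half_twist (?D\<^sub>1 \<union> ?D\<^sub>2) (d\<^sub>1 @ d\<^sub>2)" and d23: "half_twist (?D\<^sub>2 \<union> ?D\<^sub>3) (d\<^sub>2 @ d\<^sub>3)"
    by (intro half_twist_append_far_apart d1 d2 d3 far finite_atLeastLessThan)+
  obtain c\<^sub>1 where c1: "c\<^sub>1 \<in> lists {1..<2 * m}"
      "word_perm c\<^sub>1 = word_perm x \<circ> word_perm (d\<^sub>1 @ d\<^sub>2)"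
      "length c\<^sub>1 + card (block_pairs (?D\<^sub>1 \<union> ?D\<^sub>2)) = card (block_pairs {1..<2 * m})"
      "(x, c\<^sub>1 @ d\<^sub>1 @ d\<^sub>2) \<in> braid_cong ?n"
    by (rule half_twist_factor[OF x d12, of ?n]) auto
  obtain c\<^sub>2 where c2: "c\<^sub>2 \<in> lists {m + 1..<3 * m}"
      "word_perm c\<^sub>2 = word_perm y \<circ> word_perm (d\<^sub>2 @ d\<^sub>3)"
      "length c\<^sub>2 + card (block_pairs (?D\<^sub>2 \<union> ?D\<^sub>3)) = card (block_pairs {m + 1..<3 * m})"
      "(y, c\<^sub>2 @ d\<^sub>2 @ d\<^sub>3) \<in> braid_cong ?n"
    by (rule half_twist_factor[OF y d23, of ?n]) auto
  have K: "x \<in> lists {1..<2 * m}" "y \<in> lists {m + 1..<3 * m}"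
    "d\<^sub>1 \<in> lists ?D\<^sub>1" "d\<^sub>2 \<in> lists ?D\<^sub>2" "d\<^sub>3 \<in> lists ?D\<^sub>3"
    using x y d1 d2 d3 by (simp_all add: half_twist_def)
  then have L: "x \<in> lists {1..<?n}" "y \<in> lists {1..<?n}" "c\<^sub>1 \<in> lists {1..<?n}" "c\<^sub>2 \<in> lists {1..<?n}"
    "d\<^sub>1 \<in> lists {1..<?n}" "d\<^sub>2 \<in> lists {1..<?n}" "d\<^sub>3 \<in> lists {1..<?n}"
    using c1(1) c2(1) by fastforce+
  note formula = word_perm_half_twist_interval[OF x] word_perm_half_twist_interval[OF y]
    word_perm_half_twist_interval[OF d1] word_perm_half_twist_interval[OF d2]
    word_perm_half_twist_interval[OF d3] word_perm_half_twist_interval[OF z]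
  \<comment> \<open>The reversals within the blocks cancel the internal part of the long reversal,
    so two neighbouring blocks are exchanged with the order inside each kept.\<close>
  have c1_apply: "word_perm c\<^sub>1 t =
      (if 1 \<le> t \<and> t \<le> m then t + m else if m < t \<and> t \<le> 2 * m then t - m else t)" for t
    unfolding c1(2) word_perm_append o_apply formula by auto
  have c2_apply: "word_perm c\<^sub>2 t =
      (if m < t \<and> t \<le> 2 * m then t + m else if 2 * m < t \<and> t \<le> 3 * m then t - m else t)" for t
    unfolding c2(2) word_perm_append o_apply formula by auto
  have wz: "word_perm (c\<^sub>1 @ c\<^sub>2 @ x @ d\<^sub>3) = word_perm z" "word_perm (c\<^sub>2 @ c\<^sub>1 @ y @ d\<^sub>1) = word_perm z"
    unfolding fun_eq_iff
  proof (safe)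
    fix t
    \<comment> \<open>One case for each block of strands, and the fixed positions on either side of
      them.\<close>
    consider "t = 0" | "1 \<le> t" "t \<le> m" | "m < t" "t \<le> 2 * m" | "2 * m < t" "t \<le> 3 * m" | "3 * m < t"
      by linarith
    note cases = this
    show "word_perm (c\<^sub>1 @ c\<^sub>2 @ x @ d\<^sub>3) t = word_perm z t"
      unfolding word_perm_append o_apply by (rule cases; auto simp add: c1_apply c2_apply formula)
    show "word_perm (c\<^sub>2 @ c\<^sub>1 @ y @ d\<^sub>1) t = word_perm z t"
      unfolding word_perm_append o_apply by (rule cases; auto simp add: c1_apply c2_apply formula)
  qed
  obtain l where l: "m = Suc l" using m by (cases m) auto
  have two_d: "2 * card (block_pairs ?D\<^sub>1) = l * m" "2 * card (block_pairs ?D\<^sub>2) = l * m"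
    "2 * card (block_pairs ?D\<^sub>3) = l * m"
    using card_block_pairs_atLeastLessThan[of 1 m] card_block_pairs_atLeastLessThan[of "m + 1" "2 * m"]
      card_block_pairs_atLeastLessThan[of "2 * m + 1" "3 * m"] l by simp_all
  have two_x: "2 * card (block_pairs {1..<2 * m}) = (2 * l + 1) * (2 * m)"
    "2 * card (block_pairs {m + 1..<3 * m}) = (2 * l + 1) * (2 * m)"
    "2 * card (block_pairs {1..<3 * m}) = (3 * l + 2) * (3 * m)"
    using card_block_pairs_atLeastLessThan[of 1 "2 * m"] card_block_pairs_atLeastLessThan[of "m + 1" "3 * m"]
      card_block_pairs_atLeastLessThan[of 1 "3 * m"] l by (simp_all add: algebra_simps)
  have Un: "card (block_pairs (?D\<^sub>1 \<union> ?D\<^sub>2)) = card (block_pairs ?D\<^sub>1) + card (block_pairs ?D\<^sub>2)"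
    "card (block_pairs (?D\<^sub>2 \<union> ?D\<^sub>3)) = card (block_pairs ?D\<^sub>2) + card (block_pairs ?D\<^sub>3)"
    using far by (simp_all add: block_pairs_Un_far_apart card_Un_disjoint finite_block_pairs)
  \<comment> \<open>With \<open>l * m\<close> as an atom the count becomes linear. Twice the lengths
    are \<open>2 l m + 2 m\<close> for each crossing, \<open>4 l m + 2 m\<close> for
    \<open>x\<close> and \<open>y\<close>, and \<open>l m\<close> for each block twist, which adds
    up to \<open>9 l m + 6 m\<close>.\<close>
  have sq: "(2 * l + 1) * (2 * m) = 4 * (l * m) + 2 * m" "(3 * l + 2) * (3 * m) = 9 * (l * m) + 6 * m"
    by (simp_all add: algebra_simps)
  have len: "length (c\<^sub>1 @ c\<^sub>2 @ x @ d\<^sub>3) = length z" "length (c\<^sub>2 @ c\<^sub>1 @ y @ d\<^sub>1) = length z"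
    using c1(3) c2(3) Un two_d two_x sq x y d1 d3 z unfolding half_twist_def length_append by linarith+
  have zl: "z \<in> lists {1..<?n}" using z by (simp add: half_twist_def)
  have "(c\<^sub>1 @ c\<^sub>2 @ x @ d\<^sub>3, z) \<in> braid_cong ?n" "(c\<^sub>2 @ c\<^sub>1 @ y @ d\<^sub>1, z) \<in> braid_cong ?n"
    by (intro braid_cong_half_twist[OF z zl] wz len; simp only: append_in_lists_conv L simp_thms)+
  then have cc: "(c\<^sub>1 @ c\<^sub>2 @ x @ d\<^sub>3, c\<^sub>2 @ c\<^sub>1 @ y @ d\<^sub>1) \<in> braid_cong ?n"
    using braid_cong.sym braid_cong.trans by blast
  \<comment> \<open>The mirror of \<open>x\<close> exchanges the first two blocks of letters, that
    of \<open>y\<close> the last two.\<close>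
  have sx: "(d\<^sub>1 @ x, x @ d\<^sub>2) \<in> braid_cong ?n" "(d\<^sub>2 @ x, x @ d\<^sub>1) \<in> braid_cong ?n"
    using half_twist_interval_swap_half_twist[OF x _ _ d2, of ?n d\<^sub>1]
      half_twist_interval_swap_half_twist[OF x _ _ d1, of ?n d\<^sub>2] d1 d2 m
    by (auto intro!: braid_cong.sym[of "x @ _"] simp: mult_2)
  have sy: "(d\<^sub>2 @ y, y @ d\<^sub>3) \<in> braid_cong ?n" "(d\<^sub>3 @ y, y @ d\<^sub>2) \<in> braid_cong ?n"
    using half_twist_interval_swap_half_twist[OF y _ _ d3, of ?n d\<^sub>2]
      half_twist_interval_swap_half_twist[OF y _ _ d2, of ?n d\<^sub>3] d2 d3 m
    by (auto intro!: braid_cong.sym[of "y @ _"] simp: mult_2)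
  have comm: "(d\<^sub>1 @ y, y @ d\<^sub>1) \<in> braid_cong ?n" "(d\<^sub>3 @ x, x @ d\<^sub>3) \<in> braid_cong ?n"
    "(d\<^sub>2 @ d\<^sub>1, d\<^sub>1 @ d\<^sub>2) \<in> braid_cong ?n" "(d\<^sub>3 @ d\<^sub>1, d\<^sub>1 @ d\<^sub>3) \<in> braid_cong ?n"
    "(d\<^sub>3 @ d\<^sub>2, d\<^sub>2 @ d\<^sub>3) \<in> braid_cong ?n"
    using braid_cong_far_apart[OF K(3,2) far(4), of ?n] braid_cong_far_apart[OF K(1,5) far(5), of ?n]
      braid_cong_far_apart[OF K(3,4) far(1), of ?n] braid_cong_far_apart[OF K(3,5) far(2), of ?n]
      braid_cong_far_apart[OF K(4,5) far(3), of ?n]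
    by (auto intro: braid_cong.sym)
  note cl = mult_braid_class append_in_lists_conv L braid_class_eq_iff
  have carr: "?cl u \<in> carrier ?M" if "u \<in> lists {1..<?n}" for u
    using that by (simp only: carrier_braid_monoid imageI)
  have "?cl x \<otimes>\<^bsub>?M\<^esub> ?cl y \<otimes>\<^bsub>?M\<^esub> ?cl x = ?cl y \<otimes>\<^bsub>?M\<^esub> ?cl x \<otimes>\<^bsub>?M\<^esub> ?cl y"
    by (rule M.braid_relation_of_blocks[where c\<^sub>1 = "?cl c\<^sub>1" and c\<^sub>2 = "?cl c\<^sub>2" and d\<^sub>1 = "?cl d\<^sub>1"
          and d\<^sub>2 = "?cl d\<^sub>2" and d\<^sub>3 = "?cl d\<^sub>3"])
      (simp_all only: carr cl c1(4) c2(4) sx sy comm cc append_assoc)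
  then show ?thesis by (simp only: cl append_assoc)
qed

lemma braid_relation_decorated_half_twists:
  assumes m: "m > 0" and J: "J \<subseteq> {1..<m}"
    and x: "half_twist {1..<2 * m} x" and y: "half_twist {m + 1..<3 * m} y" and p: "half_twist J p"
  defines "r \<equiv> map ((+) (2 * m)) p"
  shows "((x @ r) @ (y @ p) @ (x @ r), (y @ p) @ (x @ r) @ (y @ p)) \<in> braid_cong (3 * m)"
proof -
  let ?n = "3 * m" and ?D\<^sub>1 = "{1..<m}" and ?D\<^sub>2 = "{m + 1..<2 * m}" and ?D\<^sub>3 = "{2 * m + 1..<3 * m}"
  let ?M = "braid_monoid ?n" and ?cl = "braid_class ?n"
  interpret M: monoid ?M by (rule monoid_braid_monoid)
  \<comment> \<open>The mirror image of \<open>p\<close> under \<open>x\<close>: a letter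
    \<open>i\<close> goes to \<open>1 + 2 * m - 1 - i\<close>.\<close>
  define q where "q = map (\<lambda>i. 2 * m - i) p"
  have pJ: "set p \<subseteq> ?D\<^sub>1" using p J by (auto simp: half_twist_def)
  then have K: "x \<in> lists {1..<2 * m}" "y \<in> lists {m + 1..<3 * m}"
    "p \<in> lists ?D\<^sub>1" "q \<in> lists ?D\<^sub>2" "r \<in> lists ?D\<^sub>3"
    using x y by (fastforce simp: half_twist_def q_def r_def)+
  then have L: "x \<in> lists {1..<?n}" "y \<in> lists {1..<?n}"
    "p \<in> lists {1..<?n}" "q \<in> lists {1..<?n}" "r \<in> lists {1..<?n}"
    by fastforce+
  have far: "far_apart ?D\<^sub>1 ?D\<^sub>2" "far_apart ?D\<^sub>1 ?D\<^sub>3" "far_apart ?D\<^sub>2 ?D\<^sub>3"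
    "far_apart ?D\<^sub>1 {m + 1..<3 * m}" "far_apart {1..<2 * m} ?D\<^sub>3"
    by (auto simp: far_apart_def)
  have comm: "(p @ y, y @ p) \<in> braid_cong ?n" "(r @ x, x @ r) \<in> braid_cong ?n"
    "(q @ p, p @ q) \<in> braid_cong ?n" "(r @ p, p @ r) \<in> braid_cong ?n"
    "(r @ q, q @ r) \<in> braid_cong ?n"
    using braid_cong_far_apart[OF K(3,2) far(4), of ?n] braid_cong_far_apart[OF K(1,5) far(5), of ?n]
      braid_cong_far_apart[OF K(3,4) far(1), of ?n] braid_cong_far_apart[OF K(3,5) far(2), of ?n]
      braid_cong_far_apart[OF K(4,5) far(3), of ?n]
    by (auto intro: braid_cong.sym)
  \<comment> \<open>The mirrors of \<open>x\<close> and \<open>y\<close> are \<open>2 m - i\<close>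
    and \<open>4 m - i\<close>. Applied in this order they give \<open>2 m + i\<close>, so they
    carry \<open>p\<close> to \<open>q\<close> and then to \<open>r\<close>.\<close>
  have refl: "map (\<lambda>i. 1 + 2 * m - 1 - i) p = q" "map (\<lambda>i. 1 + 2 * m - 1 - i) q = p"
    "map (\<lambda>i. m + 1 + 3 * m - 1 - i) q = r" "map (\<lambda>i. m + 1 + 3 * m - 1 - i) r = q"
    using pJ by (force simp: q_def r_def intro!: map_idI)+
  have swap: "(p @ x, x @ q) \<in> braid_cong ?n" "(q @ x, x @ p) \<in> braid_cong ?n"
    "(r @ y, y @ q) \<in> braid_cong ?n" "(q @ y, y @ r) \<in> braid_cong ?n"
    using half_twist_interval_swap[OF x, of ?n q] half_twist_interval_swap[OF x, of ?n p]
      half_twist_interval_swap[OF y, of ?n q] half_twist_interval_swap[OF y, of ?n r] K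
    unfolding refl by (fastforce intro: braid_cong.sym)+
  note cl = mult_braid_class append_in_lists_conv L braid_class_eq_iff
  have carr: "?cl u \<in> carrier ?M" if "u \<in> lists {1..<?n}" for u
    using that by (simp only: carrier_braid_monoid imageI)
  have br: "(x @ y @ x, y @ x @ y) \<in> braid_cong ?n" by (rule braid_relation_overlapping_half_twists[OF m x y])
  have "(?cl x \<otimes>\<^bsub>?M\<^esub> ?cl r) \<otimes>\<^bsub>?M\<^esub> (?cl y \<otimes>\<^bsub>?M\<^esub> ?cl p) \<otimes>\<^bsub>?M\<^esub> (?cl x \<otimes>\<^bsub>?M\<^esub> ?cl r) =
      (?cl y \<otimes>\<^bsub>?M\<^esub> ?cl p) \<otimes>\<^bsub>?M\<^esub> (?cl x \<otimes>\<^bsub>?M\<^esub> ?cl r) \<otimes>\<^bsub>?M\<^esub> (?cl y \<otimes>\<^bsub>?M\<^esub> ?cl p)"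
    by (rule M.braid_relation_decorate[where q = "?cl q"])
      (simp_all only: carr cl swap comm br append_assoc)
  then show ?thesis by (simp only: cl append_assoc)
qed

section \<open>The homomorphism\<close>

text \<open>This is the universal property of the presentation: on three strands the only two
  distinct generators are adjacent, so a single braid relation in \<open>M\<close> makes evaluation
  of words well defined.\<close>

lemma braid_monoid_3_universal:
  assumes "monoid M" and ab: "a \<in> carrier M" "b \<in> carrier M"
    and br: "a \<otimes>\<^bsub>M\<^esub> b \<otimes>\<^bsub>M\<^esub> a = b \<otimes>\<^bsub>M\<^esub> a \<otimes>\<^bsub>M\<^esub> b"
  shows "\<exists>!h. h \<in> monoid_homs (braid_monoid 3) M \<and> h (braid_gen 3 1) = a \<and> h (braid_gen 3 2) = b"
proof -
  interpret M: monoid M by fact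
  let ?B = "braid_monoid 3"
  \<comment> \<open>Of the letters sent to \<open>b\<close> only 2 occurs on three strands; the
    common default keeps every \<open>g i\<close> in the carrier.\<close>
  define g where "g i = (if i = (1::nat) then a else b)" for i
  define ev where "ev u = foldr (\<lambda>i z. g i \<otimes>\<^bsub>M\<^esub> z) u \<one>\<^bsub>M\<^esub>" for u
  have g [simp]: "g i \<in> carrier M" for i using ab by (simp add: g_def)
  have ev_simps [simp]: "ev [] = \<one>\<^bsub>M\<^esub>" "ev (i # u) = g i \<otimes>\<^bsub>M\<^esub> ev u" for i u
    by (simp_all add: ev_def)
  have ev [simp]: "ev u \<in> carrier M" for u by (induction u) simp_all
  have ev_append: "ev (u @ v) = ev u \<otimes>\<^bsub>M\<^esub> ev v" for u v
    by (induction u) (simp_all add: M.m_assoc)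
  have ev_cong: "ev u = ev v" if "(u, v) \<in> braid_cong 3" for u v
    using that
  proof (induction rule: braid_cong.induct)
    case (comm i j)
    \<comment> \<open>Vacuous, since the letters 1 and 2 differ by one.\<close>
    then show ?case by auto
  next
    case (braid i j)
    then have "i = 1 \<and> j = 2 \<or> i = 2 \<and> j = 1" by auto
    then show ?case using br ab by (auto simp: g_def M.m_assoc)
  qed (simp_all add: ev_append)
  \<comment> \<open>Any representative may be evaluated, by \<open>ev_cong\<close>; the restriction
    to the carrier makes \<open>h\<close> extensional.\<close>
  define h where "h = (\<lambda>X\<in>carrier ?B. ev (SOME u. u \<in> X))"
  have h_class: "h (braid_class 3 u) = ev u" if "u \<in> lists {1..<3}" for u
  proof -
    have "u \<in> braid_class 3 u" using braid_cong.refl[OF that] by (simp add: braid_class_def)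
    then have "(SOME v. v \<in> braid_class 3 u) \<in> braid_class 3 u" by (rule someI)
    then have "ev (SOME v. v \<in> braid_class 3 u) = ev u"
      using ev_cong by (simp add: braid_class_def)
    moreover have "braid_class 3 u \<in> carrier ?B" using that by (simp only: carrier_braid_monoid imageI)
    ultimately show ?thesis by (simp add: h_def)
  qed
  show ?thesis
  proof (rule ex1I)
    have "h \<in> hom ?B M"
    proof (rule homI)
      fix X assume "X \<in> carrier ?B"
      then show "h X \<in> carrier M" by (simp add: h_def)
    next
      fix X Y assume "X \<in> carrier ?B" "Y \<in> carrier ?B"
      then obtain u v where u: "u \<in> lists {1..<3}" "X = braid_class 3 u"
        and v: "v \<in> lists {1..<3}" "Y = braid_class 3 v"
        by (auto simp only: carrier_braid_monoid)
      then show "h (X \<otimes>\<^bsub>?B\<^esub> Y) = h X \<otimes>\<^bsub>M\<^esub> h Y"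
        by (simp only: mult_braid_class h_class append_in_lists_conv ev_append)
    qed
    moreover have "h \<one>\<^bsub>?B\<^esub> = \<one>\<^bsub>M\<^esub>" by (simp add: one_braid_monoid h_class)
    moreover have "h (braid_gen 3 1) = a" "h (braid_gen 3 2) = b"
      unfolding braid_gen_def using ab by (simp_all add: h_class g_def)
    ultimately show "h \<in> monoid_homs ?B M \<and> h (braid_gen 3 1) = a \<and> h (braid_gen 3 2) = b"
      by (simp add: monoid_homs_def h_def)
  next
    fix k assume k: "k \<in> monoid_homs ?B M \<and> k (braid_gen 3 1) = a \<and> k (braid_gen 3 2) = b"
    \<comment> \<open>The values on the generators determine \<open>k\<close> on every word;
      preservation of the unit starts the induction.\<close>
    have k_class: "k (braid_class 3 u) = ev u" if "u \<in> lists {1..<3}" for u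
      using that
    proof (induction u)
      case Nil
      show ?case using k by (simp add: monoid_homs_def one_braid_monoid)
    next
      case (Cons i u)
      have i: "[i] \<in> lists {1..<3}" using Cons by simp
      have "i = 1 \<or> i = 2" using Cons(1) by auto
      then have ki: "k (braid_class 3 [i]) = g i" using k by (auto simp: g_def braid_gen_def)
      have "braid_class 3 (i # u) = braid_class 3 [i] \<otimes>\<^bsub>?B\<^esub> braid_class 3 u"
        using mult_braid_class[OF i Cons(2)] by simp
      moreover have "braid_class 3 [i] \<in> carrier ?B" "braid_class 3 u \<in> carrier ?B"
        using i Cons(2) by (simp_all only: carrier_braid_monoid imageI)
      moreover have "k \<in> hom ?B M" using k by (simp add: monoid_homs_def)
      ultimately have "k (braid_class 3 (i # u)) = k (braid_class 3 [i]) \<otimes>\<^bsub>M\<^esub> k (braid_class 3 u)"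
        by (simp only: hom_mult)
      then show ?case using ki Cons(3) by (simp only: ev_simps)
    qed
    show "k = h"
    proof (rule extensionalityI)
      show "k \<in> extensional (carrier ?B)" using k by (simp add: monoid_homs_def)
      show "h \<in> extensional (carrier ?B)" by (simp add: h_def)
      fix X assume "X \<in> carrier ?B"
      then obtain u where "u \<in> lists {1..<3}" "X = braid_class 3 u"
        by (auto simp only: carrier_braid_monoid)
      then show "k X = h X" by (simp only: k_class h_class)
    qed
  qed
qed

theorem theorem5p57:
  fixes m :: nat and J :: "nat set"
  assumes "m > 0" and "J \<subseteq> {1..m - 1}"
  shows "\<exists>!h. h \<in> monoid_homs (braid_monoid 3) (braid_monoid (3 * m)) \<and>
    h (braid_gen 3 1) =
      braid_lift (3 * m) (longest_elt (3 * m) ({1..2 * m - 1} \<union> (\<lambda>j. 2 * m + j) ` J)) \<and>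
    h (braid_gen 3 2) =
      braid_lift (3 * m) (longest_elt (3 * m) ({m + 1..3 * m - 1} \<union> J))"
proof -
  let ?n = "3 * m"
  have J: "J \<subseteq> {1..<m}" "finite J" using assms finite_subset[of J "{1..m - 1}"] by fastforce+
  have intervals: "{1..2 * m - 1} = {1..<2 * m}" "{m + 1..3 * m - 1} = {m + 1..<3 * m}"
    using assms(1) by auto
  obtain x where x: "half_twist {1..<2 * m} x" using half_twist_exists[of "{1..<2 * m}" ?n] by auto
  obtain y where y: "half_twist {m + 1..<3 * m} y" using half_twist_exists[of "{m + 1..<3 * m}" ?n] by auto
  obtain p where p: "half_twist J p" using half_twist_exists[of J ?n] J by fastforce
  let ?r = "map ((+) (2 * m)) p"
  \<comment> \<open>The letter \<open>2 * m\<close> is missing here, and the letter \<open>m\<close>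
    in the second union, so in both cases the two sets are far apart.\<close>
  have A: "half_twist ({1..<2 * m} \<union> (\<lambda>j. 2 * m + j) ` J) (x @ ?r)"
    using J by (intro half_twist_append_far_apart x half_twist_shift p) (auto simp: far_apart_def)
  have B: "half_twist ({m + 1..<3 * m} \<union> J) (y @ p)"
    using J by (intro half_twist_append_far_apart y p) (fastforce simp: far_apart_def)+
  have subs: "{1..<2 * m} \<union> (\<lambda>j. 2 * m + j) ` J \<subseteq> {1..<?n}" "{m + 1..<3 * m} \<union> J \<subseteq> {1..<?n}"
    using J by fastforce+
  have lists: "x @ ?r \<in> lists {1..<?n}" "y @ p \<in> lists {1..<?n}"
    using A B subs lists_mono unfolding half_twist_def by blast+
  \<comment> \<open>Both prescribed images are now classes of explicit words, and the decorated
    relation is the equation required by the universal property.\<close>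
  show ?thesis
    unfolding intervals braid_lift_longest_elt[OF subs(1) A] braid_lift_longest_elt[OF subs(2) B]
    using braid_relation_decorated_half_twists[OF assms(1) J(1) x y p] lists
    by (intro braid_monoid_3_universal monoid_braid_monoid)
      (simp_all only: carrier_braid_monoid imageI mult_braid_class append_in_lists_conv
        braid_class_eq_iff append_assoc)
qed

end
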